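(* Let $\mathcal H$ be a complex Hilbert space, $B\in\mathcal B^1(\mathcal H)$, and $\Phi\in\mathsf{CP}(\mathcal H)$. If $\{V_j\}_{j\in J}\subset\mathcal B(\mathcal H)$ is any set of Kraus operators of $\Phi$, then $v:=\{\mathrm{tr}(B^*V_j)\}_{j\in J}\in\ell^2(J,\mathbb C)$. Moreover, the trace of $\Phi(B^*(\cdot)B)$ is equal to $\|v\|_2^2$.
   Context: $\mathcal H$ may be non-separable. $\mathcal B^1(\mathcal H)$ denotes the trace-class operators and $\mathcal B^2(\mathcal H)$ the Hilbert-Schmidt operators, the latter a Hilbert space under $\langle X,Y\rangle_{\mathsf{HS}}=\mathrm{tr}(X^*Y)$. $\mathsf{CP}(\mathcal H)$ is the set of completely positive linear maps $\Phi:\mathcal B^1(\mathcal H)\to\mathcal B^1(\mathcal H)$ (i.e. $\mathrm{id}_n\otimes\Phi$, acting entrywise on $n\times n$ block operators in $\mathcal B^1(\mathbb C^n\otimes\mathcal H)$, preserves positive semi-definiteness for every $n\in\mathbb N$); such maps are automatically bounded. A set of Kraus operators of $\Phi$ is a family $\{V_j\}_{j\in J}\subset\mathcal B(\mathcal H)$ (with $J$ possibly uncountable) such that the finite partial sums $\sum_{j\in F}V_j^*V_j$, $F\subseteq J$ finite, are uniformly bounded in operator norm and $\Phi(A)=\sum_{j\in J}V_jAV_j^*$ for all $A\in\mathcal B^1(\mathcal H)$, where the sum is the trace-norm limit of the net of finite partial sums. $\Phi(B^*(\cdot)B)$ denotes the map $X\mapsto\Phi(B^*XB)$ on $\mathcal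 B^2(\mathcal H)$, which is a trace-class operator on the Hilbert space $\mathcal B^2(\mathcal H)$; its trace is taken in that sense. *)

theory Defs
  imports "HOL-Analysis.Analysis"
begin

section \<open>Complex Hilbert spaces\<close>

class complex_vector = real_vector +
  fixes scaleC :: "complex \<Rightarrow> 'a \<Rightarrow> 'a" (infixr \<open>*\<^sub>C\<close> 75)
  assumes scaleC_add_right: "c *\<^sub>C (x + y) = c *\<^sub>C x + c *\<^sub>C y"
    and scaleC_add_left: "(c + d) *\<^sub>C x = c *\<^sub>C x + d *\<^sub>C x"
    and scaleC_scaleC [simp]: "c *\<^sub>C d *\<^sub>C x = (c * d) *\<^sub>C x"
    and scaleR_scaleC: "r *\<^sub>R x = complex_of_real r *\<^sub>C x"

text \<open>The inner product is antilinear in its first and linear in its second argument. The underlying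
  real Hilbert space carries the real part of it as its inner product, so the norm of the class
  \<^class>\<open>real_inner\<close> is the usual one. No separability is assumed.\<close>

class complex_hilbert = complex_vector + real_inner + banach +
  fixes cinner :: "'a \<Rightarrow> 'a \<Rightarrow> complex"
  assumes cinner_commute: "cinner x y = cnj (cinner y x)"
    and cinner_add_right: "cinner x (y + z) = cinner x y + cinner x z"
    and cinner_scaleC_right [simp]: "cinner x (c *\<^sub>C y) = c * cinner x y"
    and inner_eq_Re_cinner: "inner x y = Re (cinner x y)"

lemma scaleC_one [simp]: "1 *\<^sub>C (x::'a::complex_vector) = x"
  using scaleR_scaleC[of 1 x] by simp

lemma scaleC_diff_right: "c *\<^sub>C (x - y) = c *\<^sub>C x - c *\<^sub>C (y::'a::complex_vector)"
  using scaleC_add_right[of c "x - y" y] by (simp add: algebra_simps)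

lemma cinner_add_left: "cinner (x + y) z = cinner x z + cinner y (z::'a::complex_hilbert)"
  by (metis cinner_commute cinner_add_right complex_cnj_add)

lemma cinner_scaleC_left [simp]: "cinner (c *\<^sub>C x) y = cnj c * cinner x (y::'a::complex_hilbert)"
  by (metis cinner_commute cinner_scaleC_right complex_cnj_mult)

lemma cinner_zero_right [simp]: "cinner x (0::'a::complex_hilbert) = 0"
  using cinner_add_right[of x 0 0] by simp

lemma cinner_zero_left [simp]: "cinner (0::'a::complex_hilbert) x = 0"
  using cinner_add_left[of 0 0 x] by simp

lemma cinner_minus_right: "cinner x (- y) = - cinner x (y::'a::complex_hilbert)"
  using cinner_add_right[of x y "- y"] by (simp add: eq_neg_iff_add_eq_0 add.commute)

lemma cinner_diff_right: "cinner x (y - z) = cinner x y - cinner x (z::'a::complex_hilbert)"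
  using cinner_add_right[of x y "- z"] by (simp add: cinner_minus_right)

lemma cinner_diff_left: "cinner (x - y) z = cinner x z - cinner y (z::'a::complex_hilbert)"
  by (metis cinner_commute cinner_diff_right complex_cnj_diff)

lemma cinner_sum_right: "cinner x (\<Sum>i\<in>I. f i) = (\<Sum>i\<in>I. cinner x (f i :: 'a::complex_hilbert))"
  by (induction I rule: infinite_finite_induct) (auto simp: cinner_add_right)

lemma cinner_sum_left: "cinner (\<Sum>i\<in>I. f i) x = (\<Sum>i\<in>I. cinner (f i :: 'a::complex_hilbert) x)"
  by (induction I rule: infinite_finite_induct) (auto simp: cinner_add_left)

lemma cinner_eq_0_commute: "cinner x y = 0 \<longleftrightarrow> cinner y (x::'a::complex_hilbert) = 0"
proof -
  have "cinner x y = cnj (cinner y x)" by (rule cinner_commute)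
  then show ?thesis by simp
qed

lemma norm_cinner_commute: "cmod (cinner x y) = cmod (cinner y (x::'a::complex_hilbert))"
proof -
  have "cinner x y = cnj (cinner y x)" by (rule cinner_commute)
  then show ?thesis by simp
qed

lemma cinner_self: "cinner x x = complex_of_real ((norm (x::'a::complex_hilbert))\<^sup>2)"
proof -
  have "Im (cinner x x) = 0" using cinner_commute[of x x] by (simp add: complex_eq_iff)
  moreover have "Re (cinner x x) = (norm x)\<^sup>2"
    by (metis inner_eq_Re_cinner power2_norm_eq_inner)
  ultimately show ?thesis by (simp add: complex_eq_iff)
qed

lemma norm_scaleC [simp]: "norm (c *\<^sub>C (x::'a::complex_hilbert)) = cmod c * norm x"
proof -
  have "cinner (c *\<^sub>C x) (c *\<^sub>C x) = complex_of_real ((cmod c * norm x)\<^sup>2)"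
    using complex_norm_square[of c] by (simp add: cinner_self[of x] power_mult_distrib)
  then have "(norm (c *\<^sub>C x))\<^sup>2 = (cmod c * norm x)\<^sup>2"
    by (simp only: cinner_self of_real_eq_iff)
  then show ?thesis by (simp add: power2_eq_iff_nonneg)
qed

lemma cinner_Cauchy_Schwarz: "cmod (cinner x y) \<le> norm x * norm (y::'a::complex_hilbert)"
proof (cases "cinner x y = 0")
  case False
  define c where "c = cnj (sgn (cinner x y))"
  have "cmod c = 1" using False by (simp add: c_def norm_sgn)
  have "c * cinner x y = of_real (cmod (cinner x y))"
    using False complex_norm_square[of "cinner x y"]
    unfolding c_def sgn_eq by (simp add: field_simps power2_eq_square)
  then have "cmod (cinner x y) = inner x (c *\<^sub>C y)"
    by (simp add: inner_eq_Re_cinner)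
  also have "\<dots> \<le> norm x * norm (c *\<^sub>C y)" by (rule norm_cauchy_schwarz)
  finally show ?thesis using \<open>cmod c = 1\<close> by simp
qed simp

lemma cinner_eqI: "x = (y::'a::complex_hilbert)" if "\<And>z. cinner x z = cinner y z"
proof -
  have "cinner (x - y) (x - y) = 0" using that[of "x - y"] by (simp add: cinner_diff_left)
  then show ?thesis by (simp add: cinner_self)
qed

lemma cinner_eqI': "x = (y::'a::complex_hilbert)" if "\<And>z. cinner z x = cinner z y"
  by (rule cinner_eqI) (metis cinner_commute that)

lemma bounded_linear_scaleC: "bounded_linear (\<lambda>x::'a::complex_hilbert. c *\<^sub>C x)"
proof (rule bounded_linear_intro[where K = "cmod c"])
  show "c *\<^sub>C r *\<^sub>R x = r *\<^sub>R c *\<^sub>C x" for r and x :: 'a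
    by (simp add: scaleR_scaleC mult.commute)
qed (simp_all add: scaleC_add_right mult.commute)

lemma bounded_linear_cinner_right: "bounded_linear (\<lambda>y::'a::complex_hilbert. cinner x y)"
proof (rule bounded_linear_intro[where K = "norm x"])
  show "cmod (cinner x y) \<le> norm y * norm x" for y
    using cinner_Cauchy_Schwarz[of x y] by (simp add: mult.commute)
qed (auto simp: cinner_add_right scaleR_scaleC scaleR_conv_of_real)

lemma tendsto_cinner_right: "(f \<longlongrightarrow> (l::'a::complex_hilbert)) F \<Longrightarrow> ((\<lambda>n. cinner x (f n)) \<longlongrightarrow> cinner x l) F"
  by (rule bounded_linear.tendsto[OF bounded_linear_cinner_right])

lemma real_Riesz:
  fixes f :: "'a::{real_inner,banach} \<Rightarrow> real"
  assumes "bounded_linear f"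
  shows "\<exists>z. \<forall>y. f y = inner z y"
proof -
  interpret f: bounded_linear f by fact
  obtain K where K: "\<And>x. norm (f x) \<le> norm x * K" using f.bounded by blast
  define Q where "Q x = (norm x)\<^sup>2 / 2 - f x" for x
  have lb: "- K\<^sup>2 / 2 \<le> Q x" for x
  proof -
    have "0 \<le> (norm x - K)\<^sup>2" by simp
    moreover have "f x \<le> norm x * K" using K[of x] by simp
    ultimately show ?thesis by (simp add: Q_def power2_eq_square algebra_simps)
  qed
  then have bdd: "bdd_below (range Q)" by (intro bdd_belowI2)
  define m where "m = Inf (range Q)"
  have m: "m \<le> Q x" for x unfolding m_def by (rule cInf_lower[OF _ bdd]) simp
  have "\<exists>x. Q x < m + inverse (real (Suc n))" for n
    using cInf_lessD[of "range Q" "m + inverse (real (Suc n))"] unfolding m_def[symmetric]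
    by fastforce
  then obtain x where x: "\<And>n. Q (x n) < m + inverse (real (Suc n))" by metis
  have mid: "(norm (a - b))\<^sup>2 / 4 = Q a + Q b - 2 * Q ((1/2) *\<^sub>R (a + b))" for a b
    by (simp add: Q_def f.add f.scaleR power2_norm_eq_inner algebra_simps inner_commute)
      (simp add: field_simps)
  have est: "(norm (x i - x j))\<^sup>2 < 4 * (inverse (real (Suc i)) + inverse (real (Suc j)))" for i j
    using mid[of "x i" "x j"] x[of i] x[of j] m[of "(1/2) *\<^sub>R (x i + x j)"] by simp
  have "Cauchy x"
  proof (rule CauchyI)
    fix e :: real assume "0 < e"
    then obtain N where N: "inverse (real (Suc N)) < e\<^sup>2 / 8"
      using reals_Archimedean[of "e\<^sup>2 / 8"] by auto
    show "\<exists>M. \<forall>m\<ge>M. \<forall>n\<ge>M. norm (x m - x n) < e"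
    proof (intro exI allI impI)
      fix i j assume "N \<le> i" "N \<le> j"
      then have "inverse (real (Suc i)) \<le> inverse (real (Suc N))"
        "inverse (real (Suc j)) \<le> inverse (real (Suc N))" by (auto simp: field_simps)
      moreover have "d < q" if "a \<le> c" "b \<le> c" "d < 4 * (a + b)" "c < q / 8"
        for a b c d q :: real using that by simp
      ultimately have "(norm (x i - x j))\<^sup>2 < e\<^sup>2" using est[of i j] N by blast
      then show "norm (x i - x j) < e" using \<open>0 < e\<close> by (simp add: power_less_imp_less_base)
    qed
  qed
  then obtain z where z: "x \<longlonglongrightarrow> z" using Cauchy_convergent convergent_def by blast
  have "(\<lambda>n. Q (x n)) \<longlonglongrightarrow> Q z"
    unfolding Q_def by (intro tendsto_intros z f.tendsto) simp
  moreover have "(\<lambda>n. m + inverse (real (Suc n))) \<longlonglongrightarrow> m + 0"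
    by (intro tendsto_intros LIMSEQ_inverse_real_of_nat)
  ultimately have "Q z \<le> m + 0"
    by (rule LIMSEQ_le) (use x less_imp_le in blast)
  then have min: "Q z \<le> Q y" for y using m[of y] by simp
  have "f y = inner z y" for y
  proof (rule ccontr)
    assume ne: "f y \<noteq> inner z y"
    define d where "d = f y - inner z y"
    have "y \<noteq> 0" using ne by (auto simp: f.zero)
    define t where "t = d / (norm y)\<^sup>2"
    have "Q (z + t *\<^sub>R y) = Q z + t\<^sup>2 * (norm y)\<^sup>2 / 2 - t * d"
      by (simp add: Q_def d_def f.add f.scaleR power2_norm_eq_inner inner_commute
          algebra_simps) (simp add: field_simps power2_eq_square)
    also have "t\<^sup>2 * (norm y)\<^sup>2 = d\<^sup>2 / (norm y)\<^sup>2"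
      using \<open>y \<noteq> 0\<close> by (simp add: t_def field_simps power2_eq_square)
    also have "t * d = d\<^sup>2 / (norm y)\<^sup>2" by (simp add: t_def power2_eq_square)
    finally have "d\<^sup>2 / (norm y)\<^sup>2 \<le> 0" using min[of "z + t *\<^sub>R y"] by simp
    then show False using ne \<open>y \<noteq> 0\<close> by (simp add: d_def divide_le_0_iff)
  qed
  then show ?thesis by blast
qed

lemma complex_Riesz:
  fixes f :: "'a::complex_hilbert \<Rightarrow> complex"
  assumes "bounded_linear f" and f_scaleC: "\<And>c x. f (c *\<^sub>C x) = c * f x"
  shows "\<exists>z. \<forall>y. f y = cinner z y"
proof -
  obtain z where z: "\<And>y. Re (f y) = inner z y"
    using real_Riesz[OF bounded_linear_compose[OF bounded_linear_Re assms(1)]] by auto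
  have "f y = cinner z y" for y
    using z[of y] z[of "\<i> *\<^sub>C y"] by (simp add: f_scaleC inner_eq_Re_cinner complex_eq_iff)
  then show ?thesis by blast
qed


section \<open>Orthonormal bases\<close>

definition orthonormal :: "'a::complex_hilbert set \<Rightarrow> bool" where
  "orthonormal E \<longleftrightarrow> (\<forall>e\<in>E. \<forall>f\<in>E. cinner e f = (if e = f then 1 else 0))"

definition is_onb :: "'a::complex_hilbert set \<Rightarrow> bool" where
  "is_onb E \<longleftrightarrow> orthonormal E \<and> (\<forall>x. (\<forall>e\<in>E. cinner e x = 0) \<longrightarrow> x = 0)"

lemma is_onb_exists: "\<exists>E::'a::complex_hilbert set. is_onb E"
proof -
  have "\<exists>M\<in>{E::'a set. orthonormal E}. \<forall>X\<in>{E. orthonormal E}. M \<subseteq> X \<longrightarrow> X = M"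
  proof (rule subset_Zorn')
    fix C :: "'a set set" assume C: "subset.chain {E. orthonormal E} C"
    show "\<Union>C \<in> {E. orthonormal E}"
      unfolding mem_Collect_eq orthonormal_def
    proof (intro ballI)
      fix e f assume "e \<in> \<Union>C" "f \<in> \<Union>C"
      then obtain X Y where XY: "X \<in> C" "e \<in> X" "Y \<in> C" "f \<in> Y" by blast
      have "X \<subseteq> Y \<or> Y \<subseteq> X" using C XY unfolding subset.chain_def by blast
      with XY obtain Z where "Z \<in> C" "e \<in> Z" "f \<in> Z" by blast
      moreover have "orthonormal Z" using C \<open>Z \<in> C\<close> by (auto simp: subset.chain_def)
      ultimately show "cinner e f = (if e = f then 1 else 0)" by (auto simp: orthonormal_def)
    qed
  qed
  then obtain E :: "'a set" where E: "orthonormal E"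
    and max: "\<And>X. orthonormal X \<Longrightarrow> E \<subseteq> X \<Longrightarrow> X = E" by blast
  have "x = 0" if x: "\<forall>e\<in>E. cinner e x = 0" for x
  proof (rule ccontr)
    assume "x \<noteq> 0"
    define u where "u = complex_of_real (inverse (norm x)) *\<^sub>C x"
    have "cinner u u = 1" using \<open>x \<noteq> 0\<close> 
      by (simp add: u_def cinner_self[of x] power2_eq_square field_simps)
    moreover have eu: "cinner e u = 0" if "e \<in> E" for e using x that by (simp add: u_def)
    moreover have "cinner u e = 0" if "e \<in> E" for e
      using eu[OF that] by (simp add: cinner_eq_0_commute)
    ultimately have "orthonormal (insert u E)"
      using E by (auto simp: orthonormal_def)
    then have "u \<in> E" using max by blast
    then show False using eu[of u] \<open>cinner u u = 1\<close> by simp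
  qed
  with E show ?thesis unfolding is_onb_def by blast
qed

text \<open>Traces are computed in this basis; they do not depend on which one it is.\<close>

definition onb :: "'a::complex_hilbert set" where
  "onb = (SOME E. is_onb E)"

lemma is_onb_onb: "is_onb onb"
  unfolding onb_def by (rule someI_ex[OF is_onb_exists])

lemma orthonormal_onb: "orthonormal onb"
  by (rule conjunct1[OF is_onb_onb[unfolded is_onb_def]])

lemma Bessel:
  fixes x :: "'a::complex_hilbert"
  assumes E: "orthonormal E" "finite F" "F \<subseteq> E"
  shows "(\<Sum>e\<in>F. (cmod (cinner e x))\<^sup>2) \<le> (norm x)\<^sup>2"
proof -
  define p where "p = (\<Sum>e\<in>F. cinner e x *\<^sub>C e)"
  have ip: "cinner e p = cinner e x" if "e \<in> F" for e
  proof -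
    have "cinner e p = (\<Sum>f\<in>F. cinner f x * cinner e f)"
      by (simp add: p_def cinner_sum_right)
    also have "\<dots> = (\<Sum>f\<in>F. if f = e then cinner f x else 0)"
      using E(1) subsetD[OF E(3)] that by (intro sum.cong) (auto simp: orthonormal_def)
    finally show ?thesis using that E by simp
  qed
  have "cinner p (x - p) = 0"
    by (simp add: p_def cinner_sum_left) (simp add: cinner_diff_right ip flip: p_def)
  then have "inner p (x - p) = 0" by (simp add: inner_eq_Re_cinner)
  then have "(norm x)\<^sup>2 = (norm p)\<^sup>2 + (norm (x - p))\<^sup>2"
    by (simp add: power2_norm_eq_inner algebra_simps inner_commute)
  moreover have "complex_of_real ((norm p)\<^sup>2) = of_real (\<Sum>e\<in>F. (cmod (cinner e x))\<^sup>2)"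
    unfolding cinner_self[symmetric]
    by (subst p_def) (simp add: cinner_sum_left ip complex_norm_square mult.commute
        del: of_real_power)
  ultimately show ?thesis by (simp only: of_real_eq_iff) simp
qed

lemma Bessel_infsum:
  fixes x :: "'a::complex_hilbert"
  assumes "orthonormal E"
  shows "(\<lambda>e. (cmod (cinner e x))\<^sup>2) summable_on E"
    and "(\<Sum>\<^sub>\<infinity>e\<in>E. (cmod (cinner e x))\<^sup>2) \<le> (norm x)\<^sup>2"
proof -
  show *: "(\<lambda>e. (cmod (cinner e x))\<^sup>2) summable_on E"
    by (rule nonneg_bounded_partial_sums_imp_summable_on[where C = "(norm x)\<^sup>2"])
      (auto intro!: eventually_finite_subsets_at_top_weakI Bessel[OF assms])
  show "(\<Sum>\<^sub>\<infinity>e\<in>E. (cmod (cinner e x))\<^sup>2) \<le> (norm x)\<^sup>2"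
    by (rule infsum_le_finite_sums[OF *]) (auto intro!: Bessel[OF assms])
qed

lemma Parseval:
  fixes x :: "'a::complex_hilbert"
  assumes "is_onb E"
  shows "(\<Sum>\<^sub>\<infinity>e\<in>E. (cmod (cinner e x))\<^sup>2) = (norm x)\<^sup>2"
proof -
  have E: "orthonormal E" using assms by (simp add: is_onb_def)
  define g where "g y = (\<Sum>\<^sub>\<infinity>e\<in>E. cinner x e * cinner e y)" for y
  have partial: "(\<Sum>e\<in>F. norm (cinner x e * cinner e y)) \<le> norm x * norm y"
    if "finite F" "F \<subseteq> E" for F y
  proof -
    have "(\<Sum>e\<in>F. norm (cinner x e * cinner e y))\<^sup>2
        = (\<Sum>e\<in>F. cmod (cinner e x) * cmod (cinner e y))\<^sup>2"
      by (simp add: norm_mult norm_cinner_commute[of x])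
    also have "\<dots> \<le> (\<Sum>e\<in>F. (cmod (cinner e x))\<^sup>2) * (\<Sum>e\<in>F. (cmod (cinner e y))\<^sup>2)"
      by (rule Cauchy_Schwarz_ineq_sum)
    also have "\<dots> \<le> (norm x)\<^sup>2 * (norm y)\<^sup>2"
      by (intro mult_mono Bessel[OF E that] sum_nonneg) auto
    finally have "(\<Sum>e\<in>F. norm (cinner x e * cinner e y))\<^sup>2 \<le> (norm x * norm y)\<^sup>2"
      by (simp add: power_mult_distrib)
    then show ?thesis by (rule power2_le_imp_le) simp
  qed
  have abs: "(\<lambda>e. norm (cinner x e * cinner e y)) summable_on E" for y
    by (rule nonneg_bounded_partial_sums_imp_summable_on[where C = "norm x * norm y"])
      (auto intro!: eventually_finite_subsets_at_top_weakI partial)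
  have summ: "(\<lambda>e. cinner x e * cinner e y) summable_on E" for y
    by (rule abs_summable_summable[OF abs])
  have gC: "g (c *\<^sub>C y) = c * g y" for c y
    unfolding g_def by (subst infsum_cmult_right'[symmetric]) (simp add: algebra_simps)
  have "bounded_linear g"
  proof (rule bounded_linear_intro[where K = "norm x"])
    show "g (y + z) = g y + g z" for y z
      unfolding g_def using infsum_add[OF summ[of y] summ[of z]]
      by (simp add: cinner_add_right distrib_left)
    show "g (r *\<^sub>R y) = r *\<^sub>R g y" for r y
      by (simp add: scaleR_scaleC gC scaleR_conv_of_real)
    show "norm (g y) \<le> norm y * norm x" for y
    proof -
      have "norm (g y) \<le> (\<Sum>\<^sub>\<infinity>e\<in>E. norm (cinner x e * cinner e y))"
        unfolding g_def by (rule norm_infsum_bound[OF abs])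
      also have "\<dots> \<le> norm x * norm y" by (rule infsum_le_finite_sums[OF abs partial])
      finally show ?thesis by (simp add: mult.commute)
    qed
  qed
  then obtain z where z: "\<And>y. g y = cinner z y" using complex_Riesz gC by blast
  have "cinner e (z - x) = 0" if "e \<in> E" for e
  proof -
    have "g e = (\<Sum>\<^sub>\<infinity>f\<in>{e}. cinner x f * cinner f e)"
      unfolding g_def using E that
      by (intro infsum_cong_neutral) (auto simp: orthonormal_def)
    also have "\<dots> = cinner x e" using E that by (simp add: orthonormal_def)
    finally have "cinner (z - x) e = 0" by (simp add: z cinner_diff_left)
    then show ?thesis by (subst cinner_eq_0_commute)
  qed
  then have "z = x" using assms unfolding is_onb_def by (metis eq_iff_diff_eq_0)
  then have "complex_of_real ((norm x)\<^sup>2) = g x" by (simp add: z cinner_self)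
  also have "\<dots> = (\<Sum>\<^sub>\<infinity>e\<in>E. of_real ((cmod (cinner e x))\<^sup>2))"
    unfolding g_def
    by (intro infsum_cong) (simp only: complex_norm_square cinner_commute[of x] mult.commute)
  also have "\<dots> = of_real (\<Sum>\<^sub>\<infinity>e\<in>E. (cmod (cinner e x))\<^sup>2)"
    by (intro infsumI has_sum_of_real has_sum_infsum Bessel_infsum E)
  finally show ?thesis by (simp only: of_real_eq_iff)
qed


section \<open>Operators\<close>

instantiation blinfun :: (real_normed_vector, complex_hilbert) complex_vector
begin

definition scaleC_blinfun :: "complex \<Rightarrow> ('a \<Rightarrow>\<^sub>L 'b) \<Rightarrow> 'a \<Rightarrow>\<^sub>L 'b" where
  "scaleC_blinfun c A = Blinfun (\<lambda>x. c *\<^sub>C A x)"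

lemma scaleC_blinfun_apply [simp]: "(c *\<^sub>C (A :: 'a \<Rightarrow>\<^sub>L 'b)) x = c *\<^sub>C A x"
  unfolding scaleC_blinfun_def
  by (subst bounded_linear_Blinfun_apply)
    (auto intro: bounded_linear_compose[OF bounded_linear_scaleC] blinfun.bounded_linear_right)

instance
  by standard
    (auto intro!: blinfun_eqI
      simp: blinfun.add_left blinfun.scaleR_left scaleC_add_right scaleC_add_left scaleR_scaleC)

end

text \<open>Elements of the type of bounded linear functions are only real-linear; the bounded operators of
  the complex Hilbert space are the complex-linear ones among them.\<close>

definition bounded_ops :: "('a::complex_hilbert \<Rightarrow>\<^sub>L 'a) set" where
  "bounded_ops = {A :: 'a \<Rightarrow>\<^sub>L 'a. \<forall>c x. A (c *\<^sub>C x) = c *\<^sub>C A x}"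

definition adj :: "('a::complex_hilbert \<Rightarrow>\<^sub>L 'a) \<Rightarrow> 'a \<Rightarrow>\<^sub>L 'a" where
  "adj A = (THE A' :: 'a \<Rightarrow>\<^sub>L 'a. \<forall>x y. cinner (A' x) y = cinner x (A y))"

lemma cinner_adj:
  assumes "A \<in> bounded_ops"
  shows "cinner (adj A x) y = cinner x (A y)"
proof -
  have "\<exists>z. \<forall>y. cinner x (A y) = cinner z y" for x
  proof (rule complex_Riesz)
    show "bounded_linear (\<lambda>y. cinner x (A y))"
      by (rule bounded_linear_compose[OF bounded_linear_cinner_right blinfun.bounded_linear_right])
    show "cinner x (A (c *\<^sub>C y)) = c * cinner x (A y)" for c y
      using assms by (simp add: bounded_ops_def)
  qed
  then obtain f where f: "\<And>x y. cinner (f x) y = cinner x (A y)" by metis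
  have "bounded_linear f"
  proof (rule bounded_linear_intro[where K = "norm A"])
    show "f (x + y) = f x + f y" for x y
      by (rule cinner_eqI) (simp add: f cinner_add_left)
    show "f (r *\<^sub>R x) = r *\<^sub>R f x" for r x
      by (rule cinner_eqI) (simp add: f scaleR_scaleC)
    show "norm (f x) \<le> norm x * norm A" for x
    proof (cases "f x = 0")
      case False
      have "(norm (f x))\<^sup>2 = cmod (cinner x (A (f x)))"
        using f[of x "f x"] by (metis cinner_self norm_of_real abs_of_nonneg zero_le_power2)
      also have "\<dots> \<le> norm x * norm (A (f x))" by (rule cinner_Cauchy_Schwarz)
      also have "\<dots> \<le> norm x * (norm A * norm (f x))"
        by (intro mult_left_mono norm_blinfun) auto
      finally show ?thesis using False by (simp add: power2_eq_square)
    qed simp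
  qed
  then have "\<forall>x y. cinner (Blinfun f x) y = cinner x (A y)"
    by (simp add: bounded_linear_Blinfun_apply f)
  moreover have "C = D" if "\<forall>x y. cinner (C x) y = cinner x (A y)"
    "\<forall>x y. cinner (D x) y = cinner x (A y)" for C D :: "'a \<Rightarrow>\<^sub>L 'a"
    by (intro blinfun_eqI cinner_eqI) (simp add: that)
  ultimately have "\<exists>!A'::'a \<Rightarrow>\<^sub>L 'a. \<forall>x y. cinner (A' x) y = cinner x (A y)" by blast
  from theI'[OF this] show ?thesis unfolding adj_def by blast
qed

lemma cinner_adj_right:
  assumes "A \<in> bounded_ops"
  shows "cinner x (adj A y) = cinner (A x) y"
  using cinner_adj[OF assms, of y x] cinner_commute[of x "adj A y"] cinner_commute[of "A x" y]
  by simp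

definition tr :: "('a::complex_hilbert \<Rightarrow>\<^sub>L 'a) \<Rightarrow> complex" where
  "tr A = (\<Sum>\<^sub>\<infinity>e\<in>onb. cinner e (A e))"

text \<open>The order on the complex numbers is the one of \<^theory>\<open>HOL-Library.Complex_Order\<close>, so
  that a nonnegative number is in particular real.\<close>

definition positive_op :: "('a::complex_hilbert \<Rightarrow>\<^sub>L 'a) \<Rightarrow> bool" where
  "positive_op P \<longleftrightarrow> P \<in> bounded_ops \<and> (\<forall>x. 0 \<le> cinner x (P x))"

text \<open>The unique positive square root of \<open>A\<^sup>*A\<close>.\<close>

definition abs_op :: "('a::complex_hilbert \<Rightarrow>\<^sub>L 'a) \<Rightarrow> 'a \<Rightarrow>\<^sub>L 'a" where
  "abs_op A = (SOME P. positive_op P \<and> P o\<^sub>L P = adj A o\<^sub>L A)"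

definition trace_class :: "('a::complex_hilbert \<Rightarrow>\<^sub>L 'a) set" where
  "trace_class = {A \<in> bounded_ops. (\<lambda>e. cinner e (abs_op A e)) summable_on onb}"

text \<open>Only meaningful on the trace class.\<close>

definition trace_norm :: "('a::complex_hilbert \<Rightarrow>\<^sub>L 'a) \<Rightarrow> real" where
  "trace_norm A = Re (tr (abs_op A))"

definition hilbert_schmidt :: "('a::complex_hilbert \<Rightarrow>\<^sub>L 'a) set" where
  "hilbert_schmidt = {A \<in> bounded_ops. (\<lambda>e. (norm (A e))\<^sup>2) summable_on onb}"


section \<open>The Hilbert space of Hilbert-Schmidt operators\<close>

lemma bounded_ops_add: "A \<in> bounded_ops \<Longrightarrow> B \<in> bounded_ops \<Longrightarrow> A + B \<in> bounded_ops"
  by (simp add: bounded_ops_def blinfun.add_left scaleC_add_right)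

lemma bounded_ops_scaleC: "A \<in> bounded_ops \<Longrightarrow> c *\<^sub>C A \<in> bounded_ops"
  by (simp add: bounded_ops_def mult.commute)

lemma hilbert_schmidt_0: "0 \<in> hilbert_schmidt"
  using scaleC_add_right[of _ "0::'a" 0] by (simp add: hilbert_schmidt_def bounded_ops_def)

lemma hilbert_schmidt_add:
  fixes A B :: "'a::complex_hilbert \<Rightarrow>\<^sub>L 'a"
  assumes "A \<in> hilbert_schmidt" "B \<in> hilbert_schmidt"
  shows "A + B \<in> hilbert_schmidt"
proof -
  have "(\<lambda>e. 2 * (norm (A e))\<^sup>2 + 2 * (norm (B e))\<^sup>2) summable_on onb"
    using assms by (intro summable_on_add summable_on_cmult_right) (auto simp: hilbert_schmidt_def)
  moreover have sq: "(norm (a + b))\<^sup>2 \<le> 2 * (norm a)\<^sup>2 + 2 * (norm b)\<^sup>2" for a b :: 'a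
  proof -
    have "0 \<le> inner (a - b) (a - b)" by simp
    then show ?thesis by (simp add: power2_norm_eq_inner algebra_simps inner_commute)
  qed
  ultimately have "(\<lambda>e. (norm ((A + B) e))\<^sup>2) summable_on onb"
    by (auto intro: summable_on_comparison_test simp: blinfun.add_left)
  then show ?thesis using assms by (simp add: hilbert_schmidt_def bounded_ops_add)
qed

lemma hilbert_schmidt_scaleC: "A \<in> hilbert_schmidt \<Longrightarrow> c *\<^sub>C A \<in> hilbert_schmidt"
  by (auto simp: hilbert_schmidt_def bounded_ops_scaleC power_mult_distrib
      intro: summable_on_cmult_right)

lemma hilbert_schmidt_scaleR: "A \<in> hilbert_schmidt \<Longrightarrow> r *\<^sub>R A \<in> hilbert_schmidt"
  by (simp add: scaleR_scaleC hilbert_schmidt_scaleC)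

lemma hilbert_schmidt_uminus: "A \<in> hilbert_schmidt \<Longrightarrow> - A \<in> hilbert_schmidt"
  using hilbert_schmidt_scaleR[of A "- 1"] by simp

lemma hilbert_schmidt_diff:
  "A \<in> hilbert_schmidt \<Longrightarrow> B \<in> hilbert_schmidt \<Longrightarrow> A - B \<in> hilbert_schmidt"
  using hilbert_schmidt_add[of A "- B"] hilbert_schmidt_uminus[of B] by simp

lemma tr_adj_compose:
  "A \<in> bounded_ops \<Longrightarrow> tr (adj A o\<^sub>L B) = (\<Sum>\<^sub>\<infinity>e\<in>onb. cinner (A e) (B e))"
  by (simp add: tr_def cinner_adj_right)

lemma hilbert_schmidt_summable:
  assumes "A \<in> hilbert_schmidt" "B \<in> hilbert_schmidt"
  shows "(\<lambda>e. cinner (A e) (B e)) summable_on onb"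
proof (rule abs_summable_summable)
  have "(\<lambda>e. (norm (A e))\<^sup>2 + (norm (B e))\<^sup>2) summable_on onb"
    using assms by (intro summable_on_add) (auto simp: hilbert_schmidt_def)
  then show "(\<lambda>e. norm (cinner (A e) (B e))) summable_on onb"
  proof (rule summable_on_comparison_test)
    fix e
    have "norm (cinner (A e) (B e)) \<le> norm (A e) * norm (B e)" by (rule cinner_Cauchy_Schwarz)
    also have "\<dots> \<le> (norm (A e))\<^sup>2 + (norm (B e))\<^sup>2"
    proof -
      have "0 \<le> norm (A e) * norm (B e)" by simp
      then show ?thesis using sum_squares_bound[of "norm (A e)" "norm (B e)"] by linarith
    qed
    finally show "norm (cinner (A e) (B e)) \<le> (norm (A e))\<^sup>2 + (norm (B e))\<^sup>2" .
  qed simp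
qed

lemma hilbert_schmidt_tr_self:
  assumes "A \<in> hilbert_schmidt"
  shows "tr (adj A o\<^sub>L A) = of_real (\<Sum>\<^sub>\<infinity>e\<in>onb. (norm (A e))\<^sup>2)"
proof -
  have "tr (adj A o\<^sub>L A) = (\<Sum>\<^sub>\<infinity>e\<in>onb. complex_of_real ((norm (A e))\<^sup>2))"
    using assms by (simp add: tr_adj_compose hilbert_schmidt_def cinner_self)
  also have "\<dots> = of_real (\<Sum>\<^sub>\<infinity>e\<in>onb. (norm (A e))\<^sup>2)"
    using assms by (intro infsumI has_sum_of_real has_sum_infsum) (simp add: hilbert_schmidt_def)
  finally show ?thesis .
qed

lemma hilbert_schmidt_norm_le:
  fixes A :: "'a::complex_hilbert \<Rightarrow>\<^sub>L 'a"
  assumes "A \<in> hilbert_schmidt"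
  shows "norm A \<le> sqrt (\<Sum>\<^sub>\<infinity>e\<in>onb. (norm (A e))\<^sup>2)" (is "_ \<le> sqrt ?s")
proof (rule norm_blinfun_bound)
  have A: "A \<in> bounded_ops" and summ: "(\<lambda>e. (norm (A e))\<^sup>2) summable_on onb"
    using assms by (auto simp: hilbert_schmidt_def)
  have s: "0 \<le> ?s" by (rule infsum_nonneg) simp
  then show "0 \<le> sqrt ?s" by simp
  fix x
  define z where "z = A x"
  have bnd: "(cmod (cinner e (adj A z)))\<^sup>2 \<le> (norm z)\<^sup>2 * (norm (A e))\<^sup>2" for e
  proof -
    have "cmod (cinner e (adj A z)) = cmod (cinner z (A e))"
      by (simp add: norm_cinner_commute[of e] cinner_adj[OF A])
    also have "\<dots> \<le> norm z * norm (A e)" by (rule cinner_Cauchy_Schwarz)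
    finally show ?thesis by (simp add: power_mono flip: power_mult_distrib)
  qed
  have "(norm (adj A z))\<^sup>2 = (\<Sum>\<^sub>\<infinity>e\<in>onb. (cmod (cinner e (adj A z)))\<^sup>2)"
    by (rule Parseval[OF is_onb_onb, symmetric])
  also have "\<dots> \<le> (\<Sum>\<^sub>\<infinity>e\<in>onb. (norm z)\<^sup>2 * (norm (A e))\<^sup>2)"
    by (intro infsum_mono bnd summable_on_cmult_right summ Bessel_infsum orthonormal_onb)
  also have "\<dots> = (norm z)\<^sup>2 * ?s" by (rule infsum_cmult_right')
  finally have "(norm (adj A z))\<^sup>2 \<le> (norm z * sqrt ?s)\<^sup>2"
    using s by (simp add: power_mult_distrib)
  then have adj_le: "norm (adj A z) \<le> norm z * sqrt ?s"
    by (rule power2_le_imp_le) (simp add: s)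
  have "(norm z)\<^sup>2 = cmod (cinner (adj A z) x)"
    by (simp add: cinner_adj[OF A] flip: z_def) (simp add: cinner_self norm_power)
  also have "\<dots> \<le> norm (adj A z) * norm x" by (rule cinner_Cauchy_Schwarz)
  also have "\<dots> \<le> norm z * sqrt ?s * norm x"
    by (intro mult_right_mono adj_le) simp
  finally have "norm z * norm z \<le> norm z * (sqrt ?s * norm x)"
    by (simp add: power2_eq_square mult.assoc)
  then show "norm (A x) \<le> sqrt ?s * norm x"
    using s by (cases "z = 0") (auto simp: z_def)
qed

typedef (overloaded) 'a hs = "hilbert_schmidt :: ('a::complex_hilbert \<Rightarrow>\<^sub>L 'a) set"
  morphisms op_of_hs hs_of_op
  using hilbert_schmidt_0 by blast

declare op_of_hs [simp]
lemmas hs_eq_iff = op_of_hs_inject[symmetric]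

instantiation hs :: (complex_hilbert) complex_vector
begin

definition "0 = hs_of_op 0"
definition "X + Y = hs_of_op (op_of_hs X + op_of_hs Y)"
definition "X - Y = hs_of_op (op_of_hs X - op_of_hs Y)"
definition "- X = hs_of_op (- op_of_hs X)"
definition "r *\<^sub>R X = hs_of_op (r *\<^sub>R op_of_hs X)"
definition "c *\<^sub>C X = hs_of_op (c *\<^sub>C op_of_hs X)"

lemma op_of_hs_simps [simp]:
  "op_of_hs (0 :: 'a hs) = 0"
  "op_of_hs (X + Y) = op_of_hs X + op_of_hs Y"
  "op_of_hs (X - Y) = op_of_hs X - op_of_hs Y"
  "op_of_hs (- X) = - op_of_hs X"
  "op_of_hs (r *\<^sub>R X) = r *\<^sub>R op_of_hs X"
  "op_of_hs (c *\<^sub>C X) = c *\<^sub>C op_of_hs X"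
  for X Y :: "'a hs"
  by (simp_all add: zero_hs_def plus_hs_def minus_hs_def uminus_hs_def scaleR_hs_def scaleC_hs_def
      hs_of_op_inverse hilbert_schmidt_0 hilbert_schmidt_add hilbert_schmidt_diff
      hilbert_schmidt_uminus hilbert_schmidt_scaleR hilbert_schmidt_scaleC)

instance
  by standard (simp_all add: hs_eq_iff algebra_simps scaleC_add_right scaleC_add_left scaleR_scaleC)

end

instantiation hs :: (complex_hilbert) real_inner
begin

definition "inner X Y = Re (tr (adj (op_of_hs X) o\<^sub>L op_of_hs Y))"
definition "norm X = sqrt (inner X X)" for X :: "'a hs"
definition "dist X Y = norm (X - Y)" for X Y :: "'a hs"
definition "sgn X = X /\<^sub>R norm X" for X :: "'a hs"
definition "uniformity = (INF e\<in>{0 <..}. principal {(X, Y :: 'a hs). dist X Y < e})"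
definition "open S \<longleftrightarrow> (\<forall>X\<in>S. \<forall>\<^sub>F (X', Y) in uniformity. X' = X \<longrightarrow> Y \<in> S)"
  for S :: "'a hs set"

instance
proof
  fix X Y Z :: "'a hs" and r :: real
  have inner: "inner X Y = Re (\<Sum>\<^sub>\<infinity>e\<in>onb. cinner (op_of_hs X e) (op_of_hs Y e))" for X Y :: "'a hs"
    using op_of_hs[of X] by (simp add: inner_hs_def tr_adj_compose hilbert_schmidt_def)
  have self: "inner X X = (\<Sum>\<^sub>\<infinity>e\<in>onb. (norm (op_of_hs X e))\<^sup>2)" for X :: "'a hs"
    by (simp add: inner_hs_def hilbert_schmidt_tr_self)
  show "inner X Y = inner Y X"
    unfolding inner using infsum_cnj[of "\<lambda>e. cinner (op_of_hs X e) (op_of_hs Y e)" onb]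
    by (simp flip: cinner_commute)
  show "inner (X + Y) Z = inner X Z + inner Y Z"
    unfolding inner op_of_hs_simps blinfun.add_left cinner_add_left
    by (simp add: infsum_add hilbert_schmidt_summable)
  show "inner (r *\<^sub>R X) Y = r * inner X Y"
    unfolding inner op_of_hs_simps blinfun.scaleR_left scaleR_scaleC cinner_scaleC_left
    by (simp add: infsum_cmult_right')
  show "0 \<le> inner X X"
    unfolding self by (rule infsum_nonneg) simp
  show "inner X X = 0 \<longleftrightarrow> X = 0"
  proof
    assume "inner X X = 0"
    then have "norm (op_of_hs X) \<le> 0"
      using hilbert_schmidt_norm_le[OF op_of_hs[of X]] by (simp add: self)
    then show "X = 0" by (simp add: hs_eq_iff)
  qed (simp add: self)
qed (fact dist_hs_def sgn_hs_def uniformity_hs_def open_hs_def norm_hs_def)+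

end

lemma norm_hs: "(norm X)\<^sup>2 = (\<Sum>\<^sub>\<infinity>e\<in>onb. (norm (op_of_hs X e))\<^sup>2)"
  by (simp add: power2_norm_eq_inner inner_hs_def hilbert_schmidt_tr_self)

lemma norm_op_of_hs_le: "norm (op_of_hs X) \<le> norm X"
  using hilbert_schmidt_norm_le[OF op_of_hs[of X]] by (simp flip: norm_hs)

instance hs :: (complex_hilbert) banach
proof
  fix X :: "nat \<Rightarrow> 'a hs"
  assume X: "Cauchy X"
  have "Cauchy (\<lambda>n. op_of_hs (X n))"
  proof (rule CauchyI)
    fix \<epsilon> :: real assume "0 < \<epsilon>"
    then obtain M where "\<forall>m\<ge>M. \<forall>n\<ge>M. norm (X m - X n) < \<epsilon>" using CauchyD[OF X] by blast
    moreover have "norm (op_of_hs (X m) - op_of_hs (X n)) \<le> norm (X m - X n)" for m n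
      using norm_op_of_hs_le[of "X m - X n"] by simp
    ultimately show "\<exists>M. \<forall>m\<ge>M. \<forall>n\<ge>M. norm (op_of_hs (X m) - op_of_hs (X n)) < \<epsilon>"
      using order_le_less_trans by blast
  qed
  then obtain A where A: "(\<lambda>n. op_of_hs (X n)) \<longlonglongrightarrow> A"
    using Cauchy_convergent convergent_def by blast
  then have Ax: "(\<lambda>n. op_of_hs (X n) x) \<longlonglongrightarrow> A x" for x
    by (intro tendsto_intros)
  have "A (c *\<^sub>C x) = c *\<^sub>C A x" for c x
  proof (rule LIMSEQ_unique[OF Ax])
    have "op_of_hs (X n) (c *\<^sub>C x) = c *\<^sub>C op_of_hs (X n) x" for n
      using op_of_hs[of "X n"] by (simp add: hilbert_schmidt_def bounded_ops_def)
    then show "(\<lambda>n. op_of_hs (X n) (c *\<^sub>C x)) \<longlonglongrightarrow> c *\<^sub>C A x"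
      using bounded_linear.tendsto[OF bounded_linear_scaleC Ax] by simp
  qed
  then have A_bounded: "A \<in> bounded_ops" by (simp add: bounded_ops_def)
  have partial: "(\<Sum>e\<in>F. (norm ((op_of_hs (X n) - A) e))\<^sup>2) \<le> \<epsilon>\<^sup>2"
    if M: "\<forall>m\<ge>M. \<forall>n\<ge>M. norm (X m - X n) < \<epsilon>" "M \<le> n" and F: "finite F" "F \<subseteq> onb"
    for M n \<epsilon> F
  proof (rule LIMSEQ_le_const2)
    show "(\<lambda>m. \<Sum>e\<in>F. (norm ((op_of_hs (X n) - op_of_hs (X m)) e))\<^sup>2)
        \<longlonglongrightarrow> (\<Sum>e\<in>F. (norm ((op_of_hs (X n) - A) e))\<^sup>2)"
      unfolding blinfun.diff_left by (intro tendsto_intros Ax)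
    have "(\<Sum>e\<in>F. (norm ((op_of_hs (X n) - op_of_hs (X m)) e))\<^sup>2) \<le> \<epsilon>\<^sup>2" if "M \<le> m" for m
    proof -
      have "(\<Sum>e\<in>F. (norm (op_of_hs (X n - X m) e))\<^sup>2) \<le> (norm (X n - X m))\<^sup>2"
        unfolding norm_hs using op_of_hs[of "X n - X m"] F
        by (intro finite_sum_le_infsum) (auto simp del: op_of_hs simp: hilbert_schmidt_def)
      also have "\<dots> \<le> \<epsilon>\<^sup>2"
        using M that by (intro power_mono) (auto intro: less_imp_le)
      finally show ?thesis by simp
    qed
    then show "\<exists>N. \<forall>m\<ge>N. (\<Sum>e\<in>F. (norm ((op_of_hs (X n) - op_of_hs (X m)) e))\<^sup>2) \<le> \<epsilon>\<^sup>2"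
      by blast
  qed
  have summ: "(\<lambda>e. (norm ((op_of_hs (X n) - A) e))\<^sup>2) summable_on onb"
    if "\<forall>m\<ge>M. \<forall>n\<ge>M. norm (X m - X n) < \<epsilon>" "M \<le> n" for M n \<epsilon>
    by (rule nonneg_bounded_partial_sums_imp_summable_on[where C = "\<epsilon>\<^sup>2"])
      (auto intro!: eventually_finite_subsets_at_top_weakI partial[OF that])
  obtain N where N: "\<forall>m\<ge>N. \<forall>n\<ge>N. norm (X m - X n) < 1" using CauchyD[OF X, of 1] by auto
  have "op_of_hs (X N) - A \<in> hilbert_schmidt"
    using summ[OF N, of N] op_of_hs[of "X N"] A_bounded
    by (simp add: hilbert_schmidt_def bounded_ops_def blinfun.diff_left scaleC_diff_right)
  then have "op_of_hs (X N) - (op_of_hs (X N) - A) \<in> hilbert_schmidt"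
    by (rule hilbert_schmidt_diff[OF op_of_hs])
  then have "A \<in> hilbert_schmidt" by (simp add: diff_diff_eq2)
  then obtain Y where Y: "A = op_of_hs Y" by (metis hs_of_op_inverse)
  have "X \<longlonglongrightarrow> Y"
  proof (rule LIMSEQ_I)
    fix r :: real assume "0 < r"
    then obtain M where M: "\<forall>m\<ge>M. \<forall>n\<ge>M. norm (X m - X n) < r / 2"
      using CauchyD[OF X, of "r / 2"] by auto
    have "norm (X n - Y) < r" if "M \<le> n" for n
    proof -
      have "(norm (X n - Y))\<^sup>2 \<le> (r / 2)\<^sup>2"
        unfolding norm_hs using summ[OF M that] partial[OF M that]
        by (intro infsum_le_finite_sums) (auto simp: Y)
      then have "norm (X n - Y) \<le> r / 2"
        by (rule power2_le_imp_le) (use \<open>0 < r\<close> in simp)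
      then show ?thesis using \<open>0 < r\<close> by simp
    qed
    then show "\<exists>no. \<forall>n\<ge>no. norm (X n - Y) < r" by blast
  qed
  then show "convergent X" by (auto simp: convergent_def)
qed

instantiation hs :: (complex_hilbert) complex_hilbert
begin

definition "cinner X Y = tr (adj (op_of_hs X) o\<^sub>L op_of_hs Y)"

instance
proof
  fix X Y Z :: "'a hs" and c :: complex
  have cinner: "cinner X Y = (\<Sum>\<^sub>\<infinity>e\<in>onb. cinner (op_of_hs X e) (op_of_hs Y e))" for X Y :: "'a hs"
    using op_of_hs[of X] by (simp add: cinner_hs_def tr_adj_compose hilbert_schmidt_def)
  show "cinner X Y = cnj (cinner Y X)"
    unfolding cinner infsum_cnj[symmetric] by (intro infsum_cong cinner_commute)
  show "cinner X (Y + Z) = cinner X Y + cinner X Z"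
    unfolding cinner op_of_hs_simps blinfun.add_left cinner_add_right
    by (simp add: infsum_add hilbert_schmidt_summable)
  show "cinner X (c *\<^sub>C Y) = c * cinner X Y"
    unfolding cinner by (simp add: infsum_cmult_right')
  show "inner X Y = Re (cinner X Y)"
    by (simp add: inner_hs_def cinner_hs_def)
qed

end


section \<open>Completely positive maps and Kraus operators\<close>

text \<open>Operators on the tensor product of \<open>\<complex>\<^sup>n\<close> with the Hilbert space are \<open>n \<times> n\<close> matrices of operators,
  acting on \<open>n\<close>-tuples of vectors; such a matrix is a trace-class operator iff all its entries are.\<close>

definition block_positive :: "nat \<Rightarrow> (nat \<Rightarrow> nat \<Rightarrow> 'a::complex_hilbert \<Rightarrow>\<^sub>L 'a) \<Rightarrow> bool" where
  "block_positive n A \<longleftrightarrow>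
    (\<forall>x :: nat \<Rightarrow> 'a. 0 \<le> (\<Sum>i<n. cinner (x i) (\<Sum>j<n. A i j (x j))))"

text \<open>Only the values on the trace class matter.\<close>

definition CP :: "(('a::complex_hilbert \<Rightarrow>\<^sub>L 'a) \<Rightarrow> 'a \<Rightarrow>\<^sub>L 'a) set" where
  "CP = {\<Phi>.
    (\<forall>A\<in>trace_class. \<Phi> A \<in> trace_class) \<and>
    (\<forall>A\<in>trace_class. \<forall>B\<in>trace_class. \<Phi> (A + B) = \<Phi> A + \<Phi> B) \<and>
    (\<forall>c. \<forall>A\<in>trace_class. \<Phi> (c *\<^sub>C A) = c *\<^sub>C \<Phi> A) \<and>
    (\<forall>n A. (\<forall>i<n. \<forall>j<n. A i j \<in> trace_class) \<longrightarrow> block_positive n A \<longrightarrow>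
      block_positive n (\<lambda>i j. \<Phi> (A i j)))}"

definition kraus_operators ::
  "(('a::complex_hilbert \<Rightarrow>\<^sub>L 'a) \<Rightarrow> 'a \<Rightarrow>\<^sub>L 'a) \<Rightarrow> 'j set \<Rightarrow> ('j \<Rightarrow> 'a \<Rightarrow>\<^sub>L 'a) \<Rightarrow> bool" where
  "kraus_operators \<Phi> J V \<longleftrightarrow>
    (\<forall>j\<in>J. V j \<in> bounded_ops) \<and>
    (\<exists>K. \<forall>F. finite F \<longrightarrow> F \<subseteq> J \<longrightarrow> norm (\<Sum>j\<in>F. adj (V j) o\<^sub>L V j) \<le> K) \<and>
    (\<forall>A\<in>trace_class.
      ((\<lambda>F. trace_norm (\<Phi> A - (\<Sum>j\<in>F. V j o\<^sub>L A o\<^sub>L adj (V j)))) \<longlongrightarrow> 0)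
        (finite_subsets_at_top J))"

definition ell2 :: "'j set \<Rightarrow> ('j \<Rightarrow> complex) set" where
  "ell2 J = {v. (\<lambda>j. (cmod (v j))\<^sup>2) summable_on J}"

definition ell2_norm :: "'j set \<Rightarrow> ('j \<Rightarrow> complex) \<Rightarrow> real" where
  "ell2_norm J v = sqrt (\<Sum>\<^sub>\<infinity>j\<in>J. (cmod (v j))\<^sup>2)"

end

theory Submission
  imports Defs
begin

text \<open>A trace class operator \<open>B\<close> is a sum of rank one operators \<open>|a\<^sub>e\<rangle>\<langle>b\<^sub>e|\<close> with
  \<open>\<Sum> \<parallel>a\<^sub>e\<parallel> \<parallel>b\<^sub>e\<parallel> < \<infinity>\<close>: if \<open>Q\<close> is the square root of \<open>|B|\<close> and \<open>B = U |B|\<close>, take \<open>a\<^sub>e = U Q e\<close> and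
  \<open>b\<^sub>e = Q e\<close> for the elements \<open>e\<close> of an orthonormal basis. Therefore the map
  \<open>X \<mapsto> \<Phi>(B\<^sup>* X B)\<close> is the sum over \<open>e, f\<close> of the rank one maps
  \<open>X \<mapsto> \<langle>G, X\<rangle> M\<close> with \<open>G = |a\<^sub>e\<rangle>\<langle>a\<^sub>f|\<close> and \<open>M = \<Phi>(|b\<^sub>e\<rangle>\<langle>b\<^sub>f|)\<close>. The Kraus operators bound the Hilbert-Schmidt
  norm of \<open>M\<close> by a multiple of \<open>\<parallel>b\<^sub>e\<parallel> \<parallel>b\<^sub>f\<parallel>\<close>, so that this sum converges absolutely and has trace
  \<open>\<Sum>\<^sub>e\<^sub>f \<langle>G, M\<rangle> = \<Sum>\<^sub>e\<^sub>f \<Sum>\<^sub>j \<langle>a\<^sub>e, V\<^sub>j b\<^sub>e\<rangle> \<langle>V\<^sub>j b\<^sub>f, a\<^sub>f\<rangle>\<close>. Interchanging the sums gives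
  \<open>\<Sum>\<^sub>j |\<Sum>\<^sub>e \<langle>a\<^sub>e, V\<^sub>j b\<^sub>e\<rangle>|\<^sup>2\<close>, and the inner sum is \<open>tr (B\<^sup>* V\<^sub>j)\<close>.\<close>

section \<open>Bounded operators\<close>

lemma bounded_ops_apply: "A \<in> bounded_ops \<Longrightarrow> A (c *\<^sub>C x) = c *\<^sub>C A x"
  by (simp add: bounded_ops_def)

lemma bounded_ops_scaleR: "A \<in> bounded_ops \<Longrightarrow> r *\<^sub>R A \<in> bounded_ops"
  by (simp add: scaleR_scaleC bounded_ops_scaleC)

lemma bounded_ops_diff: "A \<in> bounded_ops \<Longrightarrow> B \<in> bounded_ops \<Longrightarrow> A - B \<in> bounded_ops"
  by (simp add: bounded_ops_def blinfun.diff_left scaleC_diff_right)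

lemma bounded_ops_compose: "A \<in> bounded_ops \<Longrightarrow> B \<in> bounded_ops \<Longrightarrow> A o\<^sub>L B \<in> bounded_ops"
  by (simp add: bounded_ops_def)

lemma bounded_ops_0: "0 \<in> bounded_ops"
  using hilbert_schmidt_0 by (simp add: hilbert_schmidt_def)

lemma bounded_ops_id: "id_blinfun \<in> bounded_ops"
  by (simp add: bounded_ops_def)

lemma bounded_ops_adj:
  assumes "A \<in> bounded_ops"
  shows "adj A \<in> bounded_ops"
  unfolding bounded_ops_def mem_Collect_eq
  by (intro allI cinner_eqI) (simp add: cinner_adj[OF assms])

lemma adj_adj: "A \<in> bounded_ops \<Longrightarrow> adj (adj A) = A"
  by (intro blinfun_eqI cinner_eqI) (simp add: cinner_adj cinner_adj_right bounded_ops_adj)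

lemma bounded_ops_LIMSEQ:
  assumes "\<And>n. A n \<in> bounded_ops" "A \<longlonglongrightarrow> L"
  shows "L \<in> bounded_ops"
proof -
  have Lx: "(\<lambda>n. A n x) \<longlonglongrightarrow> L x" for x
    using assms(2) by (intro tendsto_intros)
  have "L (c *\<^sub>C x) = c *\<^sub>C L x" for c x
  proof (rule LIMSEQ_unique[OF Lx])
    show "(\<lambda>n. A n (c *\<^sub>C x)) \<longlonglongrightarrow> c *\<^sub>C L x"
      using bounded_linear.tendsto[OF bounded_linear_scaleC Lx] assms(1)
      by (simp add: bounded_ops_apply)
  qed
  then show ?thesis by (simp add: bounded_ops_def)
qed

lemma inner_le_of_norm_le:
  "norm y \<le> norm x \<Longrightarrow> inner x y \<le> (norm x)\<^sup>2"
  for x y :: "'a::real_inner"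
  using norm_cauchy_schwarz[of x y] mult_left_mono[of "norm y" "norm x" "norm x"]
  by (simp add: power2_eq_square)

lemma norm_le_of_sq_le: "(norm x)\<^sup>2 \<le> a * norm x \<Longrightarrow> 0 \<le> a \<Longrightarrow> norm x \<le> a"
  for x :: "'a::real_normed_vector"
  by (cases "x = 0") (auto simp: power2_eq_square)

lemma norm_adj_le:
  assumes "A \<in> bounded_ops"
  shows "norm (adj A) \<le> norm A"
proof (rule norm_blinfun_bound)
  show "norm (adj A x) \<le> norm A * norm x" for x
  proof (rule norm_le_of_sq_le)
    have "(norm (adj A x))\<^sup>2 = cmod (cinner x (A (adj A x)))"
      unfolding cinner_adj[OF assms, symmetric] by (simp add: cinner_self norm_power)
    also have "\<dots> \<le> norm x * norm (A (adj A x))" by (rule cinner_Cauchy_Schwarz)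
    also have "\<dots> \<le> norm x * (norm A * norm (adj A x))"
      by (intro mult_left_mono norm_blinfun) simp
    finally show "(norm (adj A x))\<^sup>2 \<le> norm A * norm x * norm (adj A x)"
      by (simp add: mult_ac)
  qed simp
qed simp

section \<open>Parseval's identity for the inner product\<close>

lemma polarization_complex:
  "4 * (cnj p * q) = complex_of_real ((cmod (p + q))\<^sup>2) - of_real ((cmod (p - q))\<^sup>2)
    - \<i> * of_real ((cmod (p + \<i> * q))\<^sup>2) + \<i> * of_real ((cmod (p - \<i> * q))\<^sup>2)"
  by (simp only: complex_norm_square complex_cnj_add complex_cnj_diff complex_cnj_mult
      complex_cnj_i) (simp add: algebra_simps)

lemma polarization_cinner:
  fixes x y :: "'a::complex_hilbert"
  shows "4 * cinner x y = complex_of_real ((norm (x + y))\<^sup>2) - of_real ((norm (x - y))\<^sup>2)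
    - \<i> * of_real ((norm (x + \<i> *\<^sub>C y))\<^sup>2) + \<i> * of_real ((norm (x - \<i> *\<^sub>C y))\<^sup>2)"
  unfolding cinner_self[symmetric]
  by (simp add: cinner_add_left cinner_add_right cinner_diff_left cinner_diff_right algebra_simps)

text \<open>Polarization reduces this to the norm identity at \<open>x + y\<close>,
  \<open>x - y\<close>, \<open>x + \<i> *\<^sub>C y\<close> and \<open>x - \<i> *\<^sub>C y\<close>;
  the scalar polarization identity turns the four coordinate series back into products.\<close>

lemma has_sum_Parseval:
  fixes x y :: "'a::complex_hilbert"
  assumes "is_onb E"
  shows "((\<lambda>e. cinner x e * cinner e y) has_sum cinner x y) E"
proof -
  have "((\<lambda>e. (cmod (cinner e z))\<^sup>2) has_sum (norm z)\<^sup>2) E" for z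
    using Parseval[OF assms, of z] Bessel_infsum(1)[of E z] assms
    by (metis has_sum_infsum is_onb_def)
  then have sq: "((\<lambda>e. complex_of_real ((cmod (cinner e z))\<^sup>2)) has_sum of_real ((norm z)\<^sup>2)) E" for z
    by (rule has_sum_of_real)
  have diff: "((\<lambda>e. f e - g e) has_sum a - b) E"
    if "(f has_sum a) E" "(g has_sum b) E" for f g :: "'a \<Rightarrow> complex" and a b
    using has_sum_add[OF that(1) has_sum_cmult_right[OF that(2), of "- 1"]] by simp
  have "((\<lambda>e. of_real ((cmod (cinner e (x + y)))\<^sup>2) - of_real ((cmod (cinner e (x - y)))\<^sup>2)
    - \<i> * of_real ((cmod (cinner e (x + \<i> *\<^sub>C y)))\<^sup>2)
    + \<i> * of_real ((cmod (cinner e (x - \<i> *\<^sub>C y)))\<^sup>2)) has_sum 4 * cinner x y) E"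
    unfolding polarization_cinner
    by (intro has_sum_add diff has_sum_cmult_right sq)
  then have "((\<lambda>e. 4 * (cnj (cinner e x) * cinner e y)) has_sum 4 * cinner x y) E"
    by (simp only: polarization_complex cinner_add_right cinner_diff_right cinner_scaleC_right)
  then have "((\<lambda>e. 4 * (cinner x e * cinner e y)) has_sum 4 * cinner x y) E"
    by (simp only: cinner_commute[symmetric])
  then show ?thesis
    by (subst (asm) has_sum_cmult_right_iff) auto
qed

text \<open>Cauchy-Schwarz and Bessel bound every finite partial sum. The bound is uniform in the
  finite set, which later yields absolute convergence of double series.\<close>

lemma Parseval_abs:
  fixes x y :: "'a::complex_hilbert"
  assumes "orthonormal E"
  shows "(\<lambda>e. cmod (cinner x e * cinner e y)) summable_on E"
    and "(\<Sum>\<^sub>\<infinity>e\<in>E. cmod (cinner x e * cinner e y)) \<le> norm x * norm y"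
proof -
  have partial: "(\<Sum>e\<in>F. cmod (cinner x e * cinner e y)) \<le> norm x * norm y"
    if "finite F" "F \<subseteq> E" for F
  proof -
    have "(\<Sum>e\<in>F. cmod (cinner x e * cinner e y))\<^sup>2
        = (\<Sum>e\<in>F. cmod (cinner e x) * cmod (cinner e y))\<^sup>2"
      by (simp add: norm_mult norm_cinner_commute[of x])
    also have "\<dots> \<le> (\<Sum>e\<in>F. (cmod (cinner e x))\<^sup>2) * (\<Sum>e\<in>F. (cmod (cinner e y))\<^sup>2)"
      by (rule Cauchy_Schwarz_ineq_sum)
    also have "\<dots> \<le> (norm x)\<^sup>2 * (norm y)\<^sup>2"
      by (intro mult_mono Bessel[OF assms that] sum_nonneg) auto
    finally have "(\<Sum>e\<in>F. cmod (cinner x e * cinner e y))\<^sup>2 \<le> (norm x * norm y)\<^sup>2"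
      by (simp add: power_mult_distrib)
    then show ?thesis by (rule power2_le_imp_le) simp
  qed
  show *: "(\<lambda>e. cmod (cinner x e * cinner e y)) summable_on E"
    by (rule nonneg_bounded_partial_sums_imp_summable_on[where C = "norm x * norm y"])
      (auto intro!: eventually_finite_subsets_at_top_weakI partial)
  show "(\<Sum>\<^sub>\<infinity>e\<in>E. cmod (cinner x e * cinner e y)) \<le> norm x * norm y"
    by (rule infsum_le_finite_sums[OF * partial])
qed

section \<open>Square roots of positive operators\<close>

text \<open>A complex quadratic form with real values is Hermitian: its values at
  \<open>x + y\<close> and \<open>x + \<i> *\<^sub>C y\<close> give the imaginary and the real part
  of the symmetry.\<close>

lemma positive_op_symmetric:
  assumes "positive_op P"
  shows "cinner x (P y) = cinner (P x) y"
proof -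
  have Im: "Im (cinner z (P z)) = 0" for z
    using assms by (simp add: positive_op_def less_eq_complex_def)
  have P: "P (c *\<^sub>C z) = c *\<^sub>C P z" for c z
    using assms by (simp add: positive_op_def bounded_ops_def)
  have "Im (cinner x (P y)) + Im (cinner y (P x)) = 0"
    using Im[of "x + y"] Im[of x] Im[of y]
    by (simp add: blinfun.add_right cinner_add_left cinner_add_right)
  moreover have "Re (cinner x (P y)) - Re (cinner y (P x)) = 0"
    using Im[of "x + \<i> *\<^sub>C y"] Im[of x] Im[of y]
    by (simp add: blinfun.add_right cinner_add_left cinner_add_right P)
  ultimately have "cinner x (P y) = cnj (cinner y (P x))"
    by (simp add: complex_eq_iff)
  then show ?thesis by (simp flip: cinner_commute)
qed

lemma positive_op_adj_compose:
  assumes "A \<in> bounded_ops"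
  shows "positive_op (adj A o\<^sub>L A)"
  using assms
  by (simp add: positive_op_def bounded_ops_compose bounded_ops_adj cinner_adj_right cinner_self
      less_eq_complex_def flip: of_real_power)

text \<open>Expand the positive form of \<open>P\<close> at \<open>x - P x\<close>; the term
  \<open>inner (P x) (P (P x))\<close> is at most \<open>(norm (P x))\<^sup>2\<close> because
  \<open>P\<close> is a contraction. In the operator order this says that the square of
  \<open>P\<close> is at most \<open>P\<close>.\<close>

lemma positive_contraction_sq_le:
  assumes "positive_op P" "norm P \<le> 1"
  shows "(norm (P x))\<^sup>2 \<le> inner x (P x)"
proof -
  define z where "z = x - P x"
  have "0 \<le> inner z (P z)"
    using assms by (simp add: positive_op_def less_eq_complex_def inner_eq_Re_cinner)
  moreover have "inner (P x) (P (P x)) \<le> (norm (P x))\<^sup>2"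
    using norm_blinfun[of P "P x"] assms(2) mult_right_mono[of "norm P" 1 "norm (P x)"]
    by (intro inner_le_of_norm_le) simp
  moreover have "inner x (P (P x)) = inner (P x) (P x)"
    by (simp add: inner_eq_Re_cinner positive_op_symmetric[OF assms(1)])
  ultimately show ?thesis
    by (simp add: z_def blinfun.diff_right inner_diff_left inner_diff_right power2_norm_eq_inner)
qed

text \<open>The square root of \<open>P = 1 - T\<close> is \<open>1 - L\<close>, where \<open>L = (T + L\<^sup>2) / 2\<close> is the limit of the
  iteration starting at \<open>0\<close>. Since \<open>\<parallel>T\<parallel> \<le> 1\<close>, its increments are dominated in norm by those of the
  scalar iteration for \<open>T = 1\<close>, which is increasing and bounded by \<open>1\<close>.\<close>

lemma positive_contraction_sqrt:
  fixes P :: "'a::complex_hilbert \<Rightarrow>\<^sub>L 'a"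
  assumes P: "positive_op P" "norm P \<le> 1"
  shows "\<exists>Q. positive_op Q \<and> Q o\<^sub>L Q = P"
proof -
  have P_bdd: "P \<in> bounded_ops" using P by (simp add: positive_op_def)
  define T where "T = id_blinfun - P"
  have T: "norm T \<le> 1"
  proof (rule norm_blinfun_bound)
    fix x
    \<comment> \<open>In the expansion of the left side, \<open>(norm (P x))\<^sup>2\<close> is
      absorbed by one of the two subtracted copies of \<open>inner x (P x)\<close>; the other copy
      is nonnegative.\<close>
    have "(norm (T x))\<^sup>2 \<le> (norm x)\<^sup>2"
      using positive_contraction_sq_le[OF P, of x]
        positive_contraction_sq_le[OF P, of x, THEN order_trans[OF zero_le_power2]]
      by (simp add: T_def blinfun.diff_left power2_norm_eq_inner inner_diff_left inner_diff_right
          inner_commute)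
    then show "norm (T x) \<le> 1 * norm x"
      by (simp add: power2_le_iff_abs_le)
  qed simp
  define Y where "Y = rec_nat 0 (\<lambda>_ Y. (1/2) *\<^sub>R (T + (Y o\<^sub>L Y)))"
  have Y_0: "Y 0 = 0" and Y_Suc: "Y (Suc n) = (1/2) *\<^sub>R (T + (Y n o\<^sub>L Y n))" for n
    by (simp_all add: Y_def)
  define y :: "nat \<Rightarrow> real" where "y = rec_nat 0 (\<lambda>_ y. (1 + y\<^sup>2) / 2)"
  have y_0: "y 0 = 0" and y_Suc: "y (Suc n) = (1 + (y n)\<^sup>2) / 2" for n
    by (simp_all add: y_def)
  have y: "0 \<le> y n \<and> y n \<le> 1" for n
    by (induction n) (auto simp: y_0 y_Suc power_le_one)
  have Y_norm: "norm (Y n) \<le> y n" for n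
  proof (induction n)
    case (Suc n)
    have "norm (Y n o\<^sub>L Y n) \<le> (y n)\<^sup>2"
      using norm_blinfun_compose[of "Y n" "Y n"] mult_mono[OF Suc Suc] y[of n]
      by (simp add: power2_eq_square)
    then have "norm (T + (Y n o\<^sub>L Y n)) \<le> 1 + (y n)\<^sup>2"
      using T by (intro norm_triangle_le) simp
    then show ?case by (simp add: Y_Suc y_Suc)
  qed (simp add: Y_0 y_0)
  have Y_step: "norm (Y (Suc n) - Y n) \<le> y (Suc n) - y n" for n
  proof (induction n)
    case (Suc n)
    let ?D = "Y (Suc n) - Y n" and ?d = "y (Suc n) - y n"
    \<comment> \<open>This splitting of a difference of squares does not commute \<open>A\<close>
      and \<open>C\<close>, and its two terms match the scalar increment of \<open>y\<close> one by
      one.\<close>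
    have "(A o\<^sub>L A) - (C o\<^sub>L C) = (A o\<^sub>L (A - C)) + ((A - C) o\<^sub>L C)" for A C :: "'a \<Rightarrow>\<^sub>L 'a"
      by (rule blinfun_eqI) (simp add: blinfun.bilinear_simps)
    then have "Y (Suc (Suc n)) - Y (Suc n) = (1/2) *\<^sub>R ((Y (Suc n) o\<^sub>L ?D) + (?D o\<^sub>L Y n))"
      unfolding Y_Suc[of "Suc n"] by (subst (2) Y_Suc) (simp flip: scaleR_diff_right)
    also have "norm \<dots> \<le> (1/2) * (y (Suc n) * ?d + ?d * y n)"
    proof -
      have "norm (Y (Suc n) o\<^sub>L ?D) \<le> y (Suc n) * ?d"
        by (rule order_trans[OF norm_blinfun_compose mult_mono[OF Y_norm Suc]]) (use y in auto)
      moreover have "norm (?D o\<^sub>L Y n) \<le> ?d * y n"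
        by (rule order_trans[OF norm_blinfun_compose mult_mono[OF Suc Y_norm]])
          (use norm_ge_zero[THEN order_trans[OF _ Suc]] in auto)
      ultimately have "norm ((Y (Suc n) o\<^sub>L ?D) + (?D o\<^sub>L Y n)) \<le> y (Suc n) * ?d + ?d * y n"
        by (intro norm_triangle_le) simp
      then show ?thesis by simp
    qed
    also have "\<dots> = y (Suc (Suc n)) - y (Suc n)"
      by (simp add: y_Suc[of "Suc n"]) (simp add: y_Suc[of n] power2_eq_square field_simps)
    finally show ?case .
  qed (use Y_norm[of 1] in \<open>simp add: Y_0 y_0\<close>)
  have Y_diff: "norm (Y (n + k) - Y n) \<le> y (n + k) - y n" for n k
  proof (induction k)
    case (Suc k)
    have "norm (Y (Suc (n + k)) - Y n) \<le> norm (Y (Suc (n + k)) - Y (n + k)) + norm (Y (n + k) - Y n)"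
      using norm_triangle_ineq[of "Y (Suc (n + k)) - Y (n + k)" "Y (n + k) - Y n"] by simp
    then show ?case using Suc Y_step[of "n + k"] by simp
  qed simp
  \<comment> \<open>The increments of \<open>y\<close> dominate norms, so they are
    nonnegative.\<close>
  have "incseq y"
    using norm_ge_zero[THEN order_trans[OF _ Y_step]] by (intro incseq_SucI) simp
  then have "convergent y"
    using y by (metis incseq_convergent convergent_def)
  then have "Cauchy y" by (rule convergent_Cauchy)
  have "Cauchy Y"
  proof (rule CauchyI')
    fix e :: real assume "0 < e"
    then obtain M where M: "\<And>m n. m \<ge> M \<Longrightarrow> n \<ge> M \<Longrightarrow> norm (y m - y n) < e"
      using CauchyD[OF \<open>Cauchy y\<close>] by blast
    have "norm (Y m - Y n) < e" if "m \<ge> M" "n > m" for m n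
      using Y_diff[of m "n - m"] M[of n m] that by (simp add: norm_minus_commute)
    then show "\<exists>M. \<forall>m\<ge>M. \<forall>n>m. dist (Y m) (Y n) < e"
      by (auto simp: dist_norm)
  qed
  then obtain L where L: "Y \<longlonglongrightarrow> L" using Cauchy_convergent convergent_def by blast
  have Y_bdd: "Y n \<in> bounded_ops" for n
    by (induction n)
      (auto simp: Y_0 Y_Suc T_def bounded_ops_0 P_bdd
        intro!: bounded_ops_scaleR bounded_ops_add bounded_ops_diff bounded_ops_compose bounded_ops_id)
  have L_bdd: "L \<in> bounded_ops" by (rule bounded_ops_LIMSEQ[OF Y_bdd L])
  have Y_sym: "cinner u (Y n v) = cinner (Y n u) v" for n u v
  proof (induction n arbitrary: u v)
    case (Suc n)
    have "cinner u (P v) = cinner (P u) v" by (rule positive_op_symmetric[OF P(1)])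
    then show ?case
      by (simp add: Y_Suc T_def blinfun.bilinear_simps scaleR_scaleC cinner_add_left
          cinner_add_right cinner_diff_left cinner_diff_right Suc)
  qed (simp add: Y_0)
  have Lx: "(\<lambda>n. Y n x) \<longlonglongrightarrow> L x" for x using L by (intro tendsto_intros)
  \<comment> \<open>Symmetry of the iterates makes the quadratic form of the limit real, so
    positivity of \<open>1 - L\<close> becomes
    \<open>inner x (L x) \<le> (norm x)\<^sup>2\<close>.\<close>
  have L_sym: "cnj (cinner x (L x)) = cinner x (L x)" for x
  proof (rule LIMSEQ_unique)
    show *: "(\<lambda>n. cinner x (Y n x)) \<longlonglongrightarrow> cinner x (L x)"
      by (rule tendsto_cinner_right[OF Lx])
    have "cnj (cinner x (Y n x)) = cinner x (Y n x)" for n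
      by (simp only: Y_sym) (simp flip: cinner_commute add: Y_sym)
    then show "(\<lambda>n. cinner x (Y n x)) \<longlonglongrightarrow> cnj (cinner x (L x))"
      using tendsto_cnj[OF *] by simp
  qed
  have "norm L \<le> 1"
  proof (rule LIMSEQ_le_const2[OF tendsto_norm[OF L]])
    show "\<exists>N. \<forall>n\<ge>N. norm (Y n) \<le> 1" using Y_norm y order_trans by blast
  qed
  then have L_le: "norm (L x) \<le> norm x" for x
    using norm_blinfun[of L x] mult_right_mono[of "norm L" 1 "norm x"] by simp
  have L_eq: "L = (1/2) *\<^sub>R (T + (L o\<^sub>L L))"
  proof (rule LIMSEQ_unique[OF LIMSEQ_Suc[OF L]])
    show "(\<lambda>n. Y (Suc n)) \<longlonglongrightarrow> (1/2) *\<^sub>R (T + (L o\<^sub>L L))"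
      unfolding Y_Suc
      by (intro tendsto_intros L bounded_bilinear.tendsto[OF bounded_bilinear_blinfun_compose])
  qed
  define Q where "Q = id_blinfun - L"
  have "positive_op Q"
    unfolding positive_op_def
  proof (intro conjI allI)
    show "Q \<in> bounded_ops" unfolding Q_def by (intro bounded_ops_diff bounded_ops_id L_bdd)
    show "0 \<le> cinner x (Q x)" for x
      using L_sym[of x] inner_le_of_norm_le[OF L_le[of x]]
      by (simp add: Q_def blinfun.diff_left cinner_diff_right cinner_self less_eq_complex_def
          inner_eq_Re_cinner complex_eq_iff flip: of_real_power)
  qed
  moreover have "Q o\<^sub>L Q = P"
  proof (rule blinfun_eqI)
    fix x
    \<comment> \<open>This is the fixed-point equation doubled; it turns
      \<open>1 - 2 L + L\<^sup>2\<close> into \<open>1 - T\<close>, which is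
      \<open>P\<close>.\<close>
    have "L x + L x = T x + L (L x)"
      by (subst (1 2) L_eq) (simp add: blinfun.bilinear_simps flip: scaleR_add_left)
    then show "(Q o\<^sub>L Q) x = P x"
      by (simp add: Q_def T_def blinfun.bilinear_simps algebra_simps)
  qed
  ultimately show ?thesis by blast
qed

lemma positive_op_scaleR:
  "positive_op P \<Longrightarrow> 0 \<le> r \<Longrightarrow> positive_op (r *\<^sub>R P)"
  by (auto simp: positive_op_def bounded_ops_scaleR blinfun.scaleR_left scaleR_scaleC[of _ "P _"]
      less_eq_complex_def)

lemma positive_op_sqrt:
  fixes P :: "'a::complex_hilbert \<Rightarrow>\<^sub>L 'a"
  assumes "positive_op P"
  shows "\<exists>Q. positive_op Q \<and> Q o\<^sub>L Q = P"
proof -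
  \<comment> \<open>The summand 1 keeps the divisor positive even when \<open>P\<close> is
    zero.\<close>
  define c where "c = norm P + 1"
  have c: "0 < c" "norm P \<le> c" by (auto simp: c_def add_nonneg_pos)
  obtain Q where Q: "positive_op Q" "Q o\<^sub>L Q = inverse c *\<^sub>R P"
    using positive_contraction_sqrt[of "inverse c *\<^sub>R P"] positive_op_scaleR[OF assms, of "inverse c"] c
    by (auto simp: field_simps)
  have "(sqrt c *\<^sub>R Q) o\<^sub>L (sqrt c *\<^sub>R Q) = c *\<^sub>R (Q o\<^sub>L Q)"
    using c by (intro blinfun_eqI) (simp add: blinfun.bilinear_simps)
  then have "(sqrt c *\<^sub>R Q) o\<^sub>L (sqrt c *\<^sub>R Q) = P" using c Q by simp
  then show ?thesis using positive_op_scaleR[OF Q(1), of "sqrt c"] c by auto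
qed

text \<open>The square root constructed above is a witness for the choice in \<open>abs_op\<close>.
  The equality of norms allows \<open>dominated_factorization\<close> to be applied in both
  directions between \<open>A\<close> and \<open>abs_op A\<close>, which takes the place of the
  polar decomposition.\<close>

lemma abs_op:
  assumes "A \<in> bounded_ops"
  shows "positive_op (abs_op A)" "norm (abs_op A x) = norm (A x)"
proof -
  have *: "positive_op (abs_op A) \<and> abs_op A o\<^sub>L abs_op A = adj A o\<^sub>L A"
    unfolding abs_op_def
    by (rule someI_ex[OF positive_op_sqrt[OF positive_op_adj_compose[OF assms]]])
  then show pos: "positive_op (abs_op A)" by simp
  have "cinner (abs_op A x) (abs_op A x) = cinner x (abs_op A (abs_op A x))"
    by (simp add: positive_op_symmetric[OF pos])
  also have "abs_op A (abs_op A x) = adj A (A x)"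
    using * by (metis blinfun_apply_blinfun_compose)
  finally have "complex_of_real ((norm (abs_op A x))\<^sup>2) = of_real ((norm (A x))\<^sup>2)"
    by (simp only: cinner_adj_right[OF assms] cinner_self)
  then show "norm (abs_op A x) = norm (A x)"
    by (simp only: of_real_eq_iff) (simp add: power2_eq_iff_nonneg)
qed

section \<open>Factorization of dominated operators\<close>

text \<open>The last property of \<open>w\<close> says that \<open>w\<close> lies in the closure of the range of \<open>P\<close>. It makes \<open>w\<close>
  unique, hence linear in \<open>f\<close>.\<close>

lemma real_Riesz_range:
  fixes f :: "'a::real_vector \<Rightarrow> real" and P :: "'a \<Rightarrow> 'b::{real_inner,banach}"
  assumes "linear f" "linear P" and f_le: "\<And>x. \<bar>f x\<bar> \<le> K * norm (P x)" and "0 \<le> K"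
  shows "\<exists>w. (\<forall>x. f x = inner w (P x)) \<and> norm w \<le> K \<and>
    (\<forall>u. (\<forall>x. inner u (P x) = 0) \<longrightarrow> inner u w = 0)"
proof -
  interpret f: linear f by fact
  interpret P: linear P by fact
  \<comment> \<open>The representing vector is sought by minimizing \<open>Q\<close>. The infimum
    need not be attained, since the range of \<open>P\<close> may fail to be closed; what converges
    is the image under \<open>P\<close> of a minimizing sequence.\<close>
  define Q where "Q x = (norm (P x))\<^sup>2 / 2 - f x" for x
  have lb: "- K\<^sup>2 / 2 \<le> Q x" for x
  proof -
    have "0 \<le> (norm (P x) - K)\<^sup>2" by simp
    then show ?thesis using f_le[of x] by (simp add: Q_def power2_eq_square algebra_simps)
  qed
  then have bdd: "bdd_below (range Q)" by (intro bdd_belowI2)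
  define m where "m = Inf (range Q)"
  have m: "m \<le> Q x" for x unfolding m_def by (rule cInf_lower[OF _ bdd]) simp
  have "\<exists>x. Q x < m + inverse (real (Suc n))" for n
    using cInf_lessD[of "range Q" "m + inverse (real (Suc n))"] unfolding m_def[symmetric]
    by fastforce
  then obtain x where x: "\<And>n. Q (x n) < m + inverse (real (Suc n))" by metis
  \<comment> \<open>Parallelogram law: as the midpoint also has value at least \<open>m\<close>,
    near-minimizers have nearby images under \<open>P\<close>.\<close>
  have mid: "(norm (P a - P b))\<^sup>2 / 4 = Q a + Q b - 2 * Q ((1/2) *\<^sub>R (a + b))" for a b
    by (simp add: Q_def f.add f.scale P.add P.scale power2_norm_eq_inner algebra_simps inner_commute)
      (simp add: field_simps)
  have est: "(norm (P (x i) - P (x j)))\<^sup>2 < 4 * (inverse (real (Suc i)) + inverse (real (Suc j)))" for i j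
    using mid[of "x i" "x j"] x[of i] x[of j] m[of "(1/2) *\<^sub>R (x i + x j)"] by simp
  have "Cauchy (\<lambda>n. P (x n))"
  proof (rule CauchyI)
    fix e :: real assume "0 < e"
    then obtain N where N: "inverse (real (Suc N)) < e\<^sup>2 / 8"
      using reals_Archimedean[of "e\<^sup>2 / 8"] by auto
    have "norm (P (x i) - P (x j)) < e" if "N \<le> i" "N \<le> j" for i j
    proof -
      have "inverse (real (Suc i)) \<le> inverse (real (Suc N))"
        "inverse (real (Suc j)) \<le> inverse (real (Suc N))" using that by (auto simp: field_simps)
      moreover have "d < q" if "a \<le> c" "b \<le> c" "d < 4 * (a + b)" "c < q / 8"
        for a b c d q :: real using that by simp
      ultimately have "(norm (P (x i) - P (x j)))\<^sup>2 < e\<^sup>2" using est[of i j] N by blast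
      then show ?thesis using \<open>0 < e\<close> by (simp add: power_less_imp_less_base)
    qed
    then show "\<exists>M. \<forall>m\<ge>M. \<forall>n\<ge>M. norm (P (x m) - P (x n)) < e" by blast
  qed
  then obtain w where w: "(\<lambda>n. P (x n)) \<longlonglongrightarrow> w" using Cauchy_convergent convergent_def by blast
  have Qx: "(\<lambda>n. Q (x n)) \<longlonglongrightarrow> m"
  proof (rule tendsto_sandwich[of "\<lambda>_. m"])
    show "(\<lambda>n. m + inverse (real (Suc n))) \<longlonglongrightarrow> m"
      using tendsto_add[OF tendsto_const[of m] LIMSEQ_inverse_real_of_nat] by simp
    show "(\<lambda>_. m) \<longlonglongrightarrow> m" by (rule tendsto_const)
  qed (use m less_imp_le[OF x] in \<open>auto simp del: of_nat_Suc\<close>)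
  \<comment> \<open>In the absence of a minimizer, the variation is made at each \<open>x n\<close>
    and the limit is taken afterwards.\<close>
  have var: "0 \<le> t * (inner w (P y) - f y) + t\<^sup>2 * (norm (P y))\<^sup>2 / 2" for t y
  proof -
    have eq: "Q (x n + t *\<^sub>R y) - Q (x n) = t * (inner (P (x n)) (P y) - f y) + t\<^sup>2 * (norm (P y))\<^sup>2 / 2" for n
      by (simp add: Q_def f.add f.scale P.add P.scale power2_norm_eq_inner inner_commute
          algebra_simps) (simp add: field_simps power2_eq_square)
    have *: "m \<le> Q (x n) + (t * (inner (P (x n)) (P y) - f y) + t\<^sup>2 * (norm (P y))\<^sup>2 / 2)" for n
      using m[of "x n + t *\<^sub>R y"] eq[of n] by linarith
    have "(\<lambda>n. Q (x n) + (t * (inner (P (x n)) (P y) - f y) + t\<^sup>2 * (norm (P y))\<^sup>2 / 2))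
      \<longlonglongrightarrow> m + (t * (inner w (P y) - f y) + t\<^sup>2 * (norm (P y))\<^sup>2 / 2)"
      by (intro tendsto_intros Qx w)
    from LIMSEQ_le_const[OF this, of m] * show ?thesis by auto
  qed
  have f_eq: "f y = inner w (P y)" for y
  proof (rule ccontr)
    assume ne: "f y \<noteq> inner w (P y)"
    define d where "d = f y - inner w (P y)"
    have Py: "P y \<noteq> 0" using ne f_le[of y] by auto
    \<comment> \<open>This \<open>t\<close> minimizes the quadratic in \<open>var\<close>; the
      minimum is \<open>- d\<^sup>2 / (2 * (norm (P y))\<^sup>2)\<close>, negative unless
      \<open>d = 0\<close>.\<close>
    define t where "t = d / (norm (P y))\<^sup>2"
    have "t\<^sup>2 * (norm (P y))\<^sup>2 = d\<^sup>2 / (norm (P y))\<^sup>2"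
      using Py by (simp add: t_def field_simps power2_eq_square)
    moreover have "inner w (P y) - f y = - d" by (simp add: d_def)
    then have "t * (inner w (P y) - f y) = - (d\<^sup>2 / (norm (P y))\<^sup>2)"
      by (simp only:) (simp add: t_def power2_eq_square)
    ultimately have "d\<^sup>2 / (norm (P y))\<^sup>2 \<le> 0" using var[of t y] by simp
    then show False using ne Py by (simp add: d_def divide_le_0_iff)
  qed
  \<comment> \<open>Along the sequence \<open>inner w (P (x n))\<close> equals
    \<open>f (x n)\<close>, to which the assumed bound applies.\<close>
  have "(norm w)\<^sup>2 \<le> K * norm w"
  proof (rule LIMSEQ_le)
    show "(\<lambda>n. inner w (P (x n))) \<longlonglongrightarrow> (norm w)\<^sup>2"
      unfolding power2_norm_eq_inner by (intro tendsto_intros w)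
    show "(\<lambda>n. K * norm (P (x n))) \<longlonglongrightarrow> K * norm w"
      by (intro tendsto_intros w)
    show "\<exists>N. \<forall>n\<ge>N. inner w (P (x n)) \<le> K * norm (P (x n))"
      using f_le by (metis f_eq abs_le_D1)
  qed
  then have "norm w \<le> K" using \<open>0 \<le> K\<close> by (rule norm_le_of_sq_le)
  moreover have "inner u w = 0" if "\<forall>x. inner u (P x) = 0" for u
    using tendsto_inner[OF tendsto_const w, of u] that by (simp add: LIMSEQ_const_iff)
  ultimately show ?thesis using f_eq by blast
qed

text \<open>The factors 1 and \<open>- \<i>\<close> pick out the real and the imaginary part.
  Identities of real inner products become complex ones in this way, the factor \<open>c\<close>
  being absorbed into a vector.\<close>

lemma complex_eqI_Re_mult:
  assumes "\<And>c :: complex. Re (c * a) = Re (c * b)"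
  shows "a = b"
  using assms[of 1] assms[of "- \<i>"] by (simp add: complex_eq_iff)

text \<open>Douglas factorization. The functional \<open>\<lambda>x. inner z (A x)\<close> is
  bounded by \<open>norm z * norm (P x)\<close>, hence is represented by a vector \<open>w z\<close>
  tested on the range of \<open>P\<close>; the adjoint of \<open>w\<close> is the required
  \<open>U\<close>.\<close>

lemma dominated_factorization:
  fixes A P :: "'a::complex_hilbert \<Rightarrow>\<^sub>L 'a"
  assumes A: "A \<in> bounded_ops" and P: "P \<in> bounded_ops"
    and le: "\<And>x. norm (A x) \<le> norm (P x)"
  shows "\<exists>U\<in>bounded_ops. norm U \<le> 1 \<and> U o\<^sub>L P = A"
proof -
  have "\<exists>w. (\<forall>x. inner z (A x) = inner w (P x)) \<and> norm w \<le> norm z \<and>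
    (\<forall>u. (\<forall>x. inner u (P x) = 0) \<longrightarrow> inner u w = 0)" for z
  proof (rule real_Riesz_range)
    show "linear (\<lambda>x. inner z (A x))"
      by (rule linearI) (simp_all add: blinfun.bilinear_simps inner_add_right)
    show "linear (blinfun_apply P)" by (rule linearI) (simp_all add: blinfun.bilinear_simps)
    show "\<bar>inner z (A x)\<bar> \<le> norm z * norm (P x)" for x
      using Cauchy_Schwarz_ineq2[of z "A x"] mult_left_mono[OF le[of x], of "norm z"] by simp
  qed simp
  then obtain w where w_in: "\<And>z x. inner z (A x) = inner (w z) (P x)"
    and w_norm: "\<And>z. norm (w z) \<le> norm z"
    and w_perp: "\<And>u z. (\<forall>x. inner u (P x) = 0) \<Longrightarrow> inner u (w z) = 0" by metis
  have w: "cinner (w z) (P x) = cinner z (A x)" for z x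
    using w_in[of z "c *\<^sub>C x" for c]
    by (intro complex_eqI_Re_mult) (simp add: inner_eq_Re_cinner bounded_ops_apply A P)
  have perp: "cinner u (w z) = 0" if u: "\<And>x. cinner u (P x) = 0" for u z
  proof (rule complex_eqI_Re_mult)
    fix c
    have "inner (cnj c *\<^sub>C u) (P x) = 0" for x
      using u by (simp add: inner_eq_Re_cinner)
    then show "Re (c * cinner u (w z)) = Re (c * 0)"
      using w_perp[of "cnj c *\<^sub>C u" z] by (simp add: inner_eq_Re_cinner)
  qed
  \<comment> \<open>The difference \<open>v - v'\<close> annihilates the range of \<open>P\<close>,
    hence by the second premise it is orthogonal to \<open>v\<close> and \<open>v'\<close> and so to
    itself. Linearity of \<open>w\<close> follows from this uniqueness.\<close>
  have uniq: "v = v'" if v: "\<And>x. cinner v (P x) = cinner v' (P x)"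
    and v': "\<And>u. (\<And>x. cinner u (P x) = 0) \<Longrightarrow> cinner u v = 0 \<and> cinner u v' = 0" for v v'
  proof -
    have "cinner (v - v') (v - v') = 0"
      using v'[of "v - v'"] v by (simp add: cinner_diff_left cinner_diff_right)
    then show ?thesis by (simp add: cinner_self)
  qed
  have add: "w (y + z) = w y + w z" for y z
    by (rule uniq) (simp_all add: w cinner_add_left cinner_add_right perp)
  have scale: "w (c *\<^sub>C z) = c *\<^sub>C w z" for c z
    by (rule uniq) (simp_all add: w perp)
  have "bounded_linear w"
    by (rule bounded_linear_intro[where K = 1]) (simp_all add: add scale scaleR_scaleC w_norm)
  then have W: "blinfun_apply (Blinfun w) = w" by (rule bounded_linear_Blinfun_apply)
  have W_bdd: "Blinfun w \<in> bounded_ops" by (simp add: bounded_ops_def W scale)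
  have "norm (Blinfun w) \<le> 1"
    by (rule norm_blinfun_bound) (simp_all add: W w_norm)
  then have "norm (adj (Blinfun w)) \<le> 1"
    using norm_adj_le[OF W_bdd] by simp
  moreover have "adj (Blinfun w) o\<^sub>L P = A"
    by (intro blinfun_eqI cinner_eqI') (simp add: cinner_adj_right[OF W_bdd] W w)
  ultimately show ?thesis using bounded_ops_adj[OF W_bdd] by blast
qed

section \<open>Nuclear representations\<close>

lemma summable_on_Times_complex:
  fixes f :: "'i \<Rightarrow> 'j \<Rightarrow> complex"
  assumes "\<And>x. x \<in> A \<Longrightarrow> (\<lambda>y. norm (f x y)) summable_on B"
    and "\<And>x. x \<in> A \<Longrightarrow> (\<Sum>\<^sub>\<infinity>y\<in>B. norm (f x y)) \<le> g x"
    and "g summable_on A"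
  shows "(\<lambda>(x, y). f x y) summable_on A \<times> B"
proof (rule abs_summable_summable)
  have "(\<lambda>x. \<Sum>\<^sub>\<infinity>y\<in>B. norm (f x y)) summable_on A"
    by (rule summable_on_comparison_test[OF assms(3,2)]) (auto intro: infsum_nonneg)
  then show "(\<lambda>z. norm (case z of (x, y) \<Rightarrow> f x y)) summable_on A \<times> B"
    unfolding Infinite_Sum.abs_summable_on_Sigma_iff using assms(1)
    by (simp add: infsum_nonneg)
qed

text \<open>The finite Cauchy-Schwarz inequality bounds all partial sums, which yields convergence
  and the estimate together.\<close>

lemma infsum_mult_le:
  fixes p q :: "'i \<Rightarrow> real"
  assumes p: "(\<lambda>i. (p i)\<^sup>2) summable_on I" "\<And>i. i \<in> I \<Longrightarrow> 0 \<le> p i"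
    and q: "(\<lambda>i. (q i)\<^sup>2) summable_on I" "\<And>i. i \<in> I \<Longrightarrow> 0 \<le> q i"
  shows "(\<lambda>i. p i * q i) summable_on I"
    and "(\<Sum>\<^sub>\<infinity>i\<in>I. p i * q i) \<le> sqrt (\<Sum>\<^sub>\<infinity>i\<in>I. (p i)\<^sup>2) * sqrt (\<Sum>\<^sub>\<infinity>i\<in>I. (q i)\<^sup>2)"
proof -
  have partial: "(\<Sum>i\<in>F. p i * q i) \<le> sqrt (\<Sum>\<^sub>\<infinity>i\<in>I. (p i)\<^sup>2) * sqrt (\<Sum>\<^sub>\<infinity>i\<in>I. (q i)\<^sup>2)"
    if F: "finite F" "F \<subseteq> I" for F
  proof -
    have "(\<Sum>i\<in>F. p i * q i) = (\<Sum>i\<in>F. \<bar>p i\<bar> * \<bar>q i\<bar>)"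
      using p(2) q(2) F by (intro sum.cong) auto
    also have "\<dots> \<le> L2_set p F * L2_set q F" by (rule L2_set_mult_ineq)
    also have "\<dots> \<le> sqrt (\<Sum>\<^sub>\<infinity>i\<in>I. (p i)\<^sup>2) * sqrt (\<Sum>\<^sub>\<infinity>i\<in>I. (q i)\<^sup>2)"
      unfolding L2_set_def using p(1) q(1) F
      by (intro mult_mono real_sqrt_le_mono finite_sum_le_infsum)
        (auto intro: infsum_nonneg sum_nonneg)
    finally show ?thesis .
  qed
  show *: "(\<lambda>i. p i * q i) summable_on I"
    by (rule nonneg_bounded_partial_sums_imp_summable_on
        [where C = "sqrt (\<Sum>\<^sub>\<infinity>i\<in>I. (p i)\<^sup>2) * sqrt (\<Sum>\<^sub>\<infinity>i\<in>I. (q i)\<^sup>2)"])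
      (auto intro!: eventually_finite_subsets_at_top_weakI partial mult_nonneg_nonneg p q)
  show "(\<Sum>\<^sub>\<infinity>i\<in>I. p i * q i) \<le> sqrt (\<Sum>\<^sub>\<infinity>i\<in>I. (p i)\<^sup>2) * sqrt (\<Sum>\<^sub>\<infinity>i\<in>I. (q i)\<^sup>2)"
    by (rule infsum_le_finite_sums[OF * partial])
qed

lemma infsum_Times_mult:
  fixes f :: "'i \<Rightarrow> complex" and g :: "'j \<Rightarrow> complex"
  assumes "f summable_on A" "g summable_on B"
  shows "(\<lambda>(x, y). f x * g y) summable_on A \<times> B"
    and "(\<Sum>\<^sub>\<infinity>(x, y)\<in>A \<times> B. f x * g y) = infsum f A * infsum g B"
proof -
  have abs: "(\<lambda>x. cmod (f x)) summable_on A" "(\<lambda>y. cmod (g y)) summable_on B"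
    using assms summable_on_iff_abs_summable_on_complex by blast+
  show *: "(\<lambda>(x, y). f x * g y) summable_on A \<times> B"
    by (rule summable_on_Times_complex[where g = "\<lambda>x. cmod (f x) * (\<Sum>\<^sub>\<infinity>y\<in>B. cmod (g y))"])
      (auto simp: norm_mult infsum_cmult_right' intro: summable_on_cmult_right summable_on_cmult_left abs)
  show "(\<Sum>\<^sub>\<infinity>(x, y)\<in>A \<times> B. f x * g y) = infsum f A * infsum g B"
    using infsum_Sigma'_banach[OF *] by (simp add: infsum_cmult_right' infsum_cmult_left')
qed

lemma summable_on_Times_real:
  fixes f :: "'i \<Rightarrow> real" and g :: "'j \<Rightarrow> real"
  assumes "f summable_on A" "g summable_on B"
  shows "(\<lambda>(x, y). f x * g y) summable_on A \<times> B"
  using summable_on_Re[OF infsum_Times_mult(1)[OF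
      summable_on_of_real[where 'a = complex, OF assms(1)]
      summable_on_of_real[where 'a = complex, OF assms(2)]]]
  by (simp add: case_prod_unfold)

text \<open>\<open>A = \<Sum>\<^sub>i |a i\<rangle>\<langle>b i|\<close>, stated for the matrix elements of \<open>A\<close>.\<close>

definition nuclear_rep ::
  "'i set \<Rightarrow> ('i \<Rightarrow> 'a) \<Rightarrow> ('i \<Rightarrow> 'a) \<Rightarrow> ('a::complex_hilbert \<Rightarrow>\<^sub>L 'a) \<Rightarrow> bool" where
  "nuclear_rep I a b A \<longleftrightarrow> A \<in> bounded_ops \<and>
    (\<lambda>i. norm (a i) * norm (b i)) summable_on I \<and>
    (\<forall>x y. ((\<lambda>i. cinner (b i) x * cinner y (a i)) has_sum cinner y (A x)) I)"

lemma nuclear_rep_compose_left: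
  assumes U: "U \<in> bounded_ops" and A: "nuclear_rep I a b A"
  shows "nuclear_rep I (\<lambda>i. U (a i)) b (U o\<^sub>L A)"
  unfolding nuclear_rep_def
proof (intro conjI allI)
  show "U o\<^sub>L A \<in> bounded_ops"
    using assms by (simp add: nuclear_rep_def bounded_ops_compose)
  have "(\<lambda>i. norm U * (norm (a i) * norm (b i))) summable_on I"
    using A by (auto simp: nuclear_rep_def intro: summable_on_cmult_right)
  then show "(\<lambda>i. norm (U (a i)) * norm (b i)) summable_on I"
  proof (rule summable_on_comparison_test)
    show "norm (U (a i)) * norm (b i) \<le> norm U * (norm (a i) * norm (b i))" for i
      using mult_right_mono[OF norm_blinfun[of U "a i"], of "norm (b i)"] by (simp add: mult.assoc)
  qed simp
  fix x y
  have "((\<lambda>i. cinner (b i) x * cinner (adj U y) (a i)) has_sum cinner (adj U y) (A x)) I"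
    using A by (simp add: nuclear_rep_def)
  then show "((\<lambda>i. cinner (b i) x * cinner y (U (a i))) has_sum cinner y ((U o\<^sub>L A) x)) I"
    by (simp add: cinner_adj[OF U])
qed

lemma nuclear_rep_adj:
  assumes A: "nuclear_rep I a b A"
  shows "nuclear_rep I b a (adj A)"
  unfolding nuclear_rep_def
proof (intro conjI allI)
  have A_bdd: "A \<in> bounded_ops" using A by (simp add: nuclear_rep_def)
  show "adj A \<in> bounded_ops" by (rule bounded_ops_adj[OF A_bdd])
  show "(\<lambda>i. norm (b i) * norm (a i)) summable_on I"
    using A by (simp add: nuclear_rep_def mult.commute)
  fix x y
  have "((\<lambda>i. cinner (b i) y * cinner x (a i)) has_sum cinner x (A y)) I"
    using A by (simp add: nuclear_rep_def)
  then have "((\<lambda>i. cnj (cinner (b i) y * cinner x (a i))) has_sum cnj (cinner x (A y))) I"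
    by (simp only: has_sum_cnj_iff)
  then show "((\<lambda>i. cinner (a i) x * cinner y (b i)) has_sum cinner y (adj A x)) I"
    by (simp add: cinner_adj_right[OF A_bdd] mult.commute flip: cinner_commute)
qed

text \<open>Composition on the right is composition on the left between two adjoints, each of which
  exchanges \<open>a\<close> and \<open>b\<close>.\<close>

lemma nuclear_rep_compose_right:
  assumes "U \<in> bounded_ops" "nuclear_rep I a b A"
  shows "nuclear_rep I a (\<lambda>i. adj U (b i)) (A o\<^sub>L U)"
proof -
  have A: "A \<in> bounded_ops" using assms by (simp add: nuclear_rep_def)
  have "adj (adj U o\<^sub>L adj A) = A o\<^sub>L U"
    using A assms(1) by (intro blinfun_eqI cinner_eqI)
      (simp add: cinner_adj cinner_adj_right bounded_ops_adj bounded_ops_compose adj_adj)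
  then show ?thesis
    using nuclear_rep_adj[OF nuclear_rep_compose_left[OF bounded_ops_adj[OF assms(1)]
          nuclear_rep_adj[OF assms(2)]]] by simp
qed

text \<open>The series of vectors converges absolutely, with a bound linear in
  \<open>norm x\<close>. Used on the space \<open>'a hs\<close>, this produces the operator whose
  trace is to be computed.\<close>

lemma nuclear_rep_exists:
  fixes a b :: "'i \<Rightarrow> 'a::complex_hilbert"
  assumes ab: "(\<lambda>i. norm (a i) * norm (b i)) summable_on I"
  shows "\<exists>A. nuclear_rep I a b A"
proof -
  define g where "g x = (\<Sum>\<^sub>\<infinity>i\<in>I. cinner (b i) x *\<^sub>C a i)" for x
  have le: "norm (cinner (b i) x *\<^sub>C a i) \<le> norm x * (norm (a i) * norm (b i))" for i x
    using mult_right_mono[OF cinner_Cauchy_Schwarz[of "b i" x], of "norm (a i)"]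
    by (simp add: mult_ac)
  have abs: "(\<lambda>i. norm (cinner (b i) x *\<^sub>C a i)) summable_on I" for x
    by (rule Infinite_Sum.abs_summable_on_comparison_test'[OF summable_on_cmult_right[OF ab] le])
  have g: "((\<lambda>i. cinner (b i) x *\<^sub>C a i) has_sum g x) I" for x
    unfolding g_def by (rule has_sum_infsum[OF abs_summable_summable[OF abs]])
  have add: "g (x + y) = g x + g y" for x y
    using has_sum_unique[OF g[of "x + y"]] has_sum_add[OF g[of x] g[of y]]
    by (simp add: cinner_add_right scaleC_add_left)
  have scale: "g (c *\<^sub>C x) = c *\<^sub>C g x" for c x
    using has_sum_unique[OF g[of "c *\<^sub>C x"]] has_sum_bounded_linear[OF bounded_linear_scaleC g[of x]]
    by simp
  have "bounded_linear g"
  proof (rule bounded_linear_intro[where K = "\<Sum>\<^sub>\<infinity>i\<in>I. norm (a i) * norm (b i)"])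
    fix x
    have "norm (g x) \<le> (\<Sum>\<^sub>\<infinity>i\<in>I. norm (cinner (b i) x *\<^sub>C a i))"
      unfolding g_def by (rule norm_infsum_bound[OF abs])
    also have "\<dots> \<le> (\<Sum>\<^sub>\<infinity>i\<in>I. norm x * (norm (a i) * norm (b i)))"
      by (rule infsum_mono[OF abs summable_on_cmult_right[OF ab] le])
    finally show "norm (g x) \<le> norm x * (\<Sum>\<^sub>\<infinity>i\<in>I. norm (a i) * norm (b i))"
      by (simp add: infsum_cmult_right')
  qed (simp_all add: add scale scaleR_scaleC)
  then have G: "blinfun_apply (Blinfun g) = g" by (rule bounded_linear_Blinfun_apply)
  have "((\<lambda>i. cinner (b i) x * cinner y (a i)) has_sum cinner y (g x)) I" for x y
    using has_sum_bounded_linear[OF bounded_linear_cinner_right g[of x], of y] by simp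
  then have "nuclear_rep I a b (Blinfun g)"
    using ab by (simp add: nuclear_rep_def bounded_ops_def G scale)
  then show ?thesis by blast
qed

text \<open>Summing over the basis first collapses the double series by Parseval;
  \<open>Parseval_abs\<close> supplies the absolute convergence that permits exchanging the
  sums.\<close>

lemma nuclear_rep_tr:
  fixes A :: "'a::complex_hilbert \<Rightarrow>\<^sub>L 'a"
  assumes A: "nuclear_rep I a b A"
  shows "(\<lambda>e. cinner e (A e)) summable_on onb"
    and "tr A = (\<Sum>\<^sub>\<infinity>i\<in>I. cinner (b i) (a i))"
proof -
  have Ae: "cinner e (A e) = (\<Sum>\<^sub>\<infinity>i\<in>I. cinner (b i) e * cinner e (a i))" for e
    using A by (auto simp: nuclear_rep_def intro!: infsumI[symmetric])
  have "(\<lambda>(i, e). cinner (b i) e * cinner e (a i)) summable_on I \<times> onb"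
  proof (rule summable_on_Times_complex)
    show "(\<lambda>i. norm (b i) * norm (a i)) summable_on I"
      using A by (simp add: nuclear_rep_def mult.commute)
  qed (rule Parseval_abs[OF orthonormal_onb])+
  then have *: "(\<lambda>(e, i). cinner (b i) e * cinner e (a i)) summable_on onb \<times> I"
    by (subst (asm) summable_on_swap) simp
  show "(\<lambda>e. cinner e (A e)) summable_on onb"
    unfolding Ae by (rule summable_on_Sigma_banach[OF *])
  show "tr A = (\<Sum>\<^sub>\<infinity>i\<in>I. cinner (b i) (a i))"
    unfolding tr_def Ae infsum_swap_banach[OF *]
    by (intro infsum_cong infsumI has_sum_Parseval is_onb_onb)
qed

text \<open>A factorization \<open>U o\<^sub>L A = abs_op A\<close> carries the representation over
  to \<open>abs_op A\<close>, whose diagonal is what the definition of \<open>trace_class\<close>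
  sums.\<close>

lemma nuclear_rep_trace_class:
  assumes A: "nuclear_rep I a b A"
  shows "A \<in> trace_class"
proof -
  have A_bdd: "A \<in> bounded_ops" using A by (simp add: nuclear_rep_def)
  have "abs_op A \<in> bounded_ops" using abs_op(1)[OF A_bdd] by (simp add: positive_op_def)
  then obtain U where U: "U \<in> bounded_ops" "U o\<^sub>L A = abs_op A"
    using dominated_factorization[of "abs_op A" A] A_bdd abs_op(2)[OF A_bdd] by auto
  show ?thesis
    using nuclear_rep_tr(1)[OF nuclear_rep_compose_left[OF U(1) A]] A_bdd
    unfolding trace_class_def U(2) by simp
qed

text \<open>By symmetry of \<open>Q\<close>, the diagonal entries of \<open>abs_op A\<close> are
  \<open>(norm (Q e))\<^sup>2\<close>, so the trace norm is a squared Hilbert-Schmidt norm.\<close>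

lemma trace_class_sqrt:
  assumes "A \<in> trace_class"
  obtains Q where "positive_op Q" "Q o\<^sub>L Q = abs_op A" "Q \<in> hilbert_schmidt"
    "trace_norm A = (\<Sum>\<^sub>\<infinity>e\<in>onb. (norm (Q e))\<^sup>2)"
proof -
  have A: "A \<in> bounded_ops" and summ: "(\<lambda>e. cinner e (abs_op A e)) summable_on onb"
    using assms by (simp_all add: trace_class_def)
  obtain Q where Q: "positive_op Q" "Q o\<^sub>L Q = abs_op A"
    using positive_op_sqrt[OF abs_op(1)[OF A]] by blast
  have Qe: "cinner e (abs_op A e) = of_real ((norm (Q e))\<^sup>2)" for e
    using positive_op_symmetric[OF Q(1), of e "Q e"]
    by (simp add: cinner_self flip: Q(2))
  have "(\<lambda>e. (norm (Q e))\<^sup>2) summable_on onb"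
    using summable_on_Re[OF summ] by (simp add: Qe flip: of_real_power)
  then have Q_hs: "Q \<in> hilbert_schmidt"
    using Q(1) by (simp add: hilbert_schmidt_def positive_op_def)
  moreover have "trace_norm A = (\<Sum>\<^sub>\<infinity>e\<in>onb. (norm (Q e))\<^sup>2)"
    using infsum_Re[OF summ] by (simp add: trace_norm_def tr_def Qe flip: of_real_power)
  ultimately show thesis using Q that by blast
qed

lemma trace_class_nuclear_rep:
  fixes A :: "'a::complex_hilbert \<Rightarrow>\<^sub>L 'a"
  assumes "A \<in> trace_class"
  shows "\<exists>a b. nuclear_rep (onb :: 'a set) a b A"
proof -
  have A: "A \<in> bounded_ops" using assms by (simp add: trace_class_def)
  obtain Q where Q: "positive_op Q" "Q o\<^sub>L Q = abs_op A" "Q \<in> hilbert_schmidt"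
    by (rule trace_class_sqrt[OF assms]) (rule that)
  have "abs_op A \<in> bounded_ops" using abs_op(1)[OF A] by (simp add: positive_op_def)
  then obtain U where U: "U \<in> bounded_ops" "norm U \<le> 1" "U o\<^sub>L abs_op A = A"
    using dominated_factorization[of A "abs_op A"] A abs_op(2)[OF A] by auto
  have "nuclear_rep (onb :: 'a set) Q Q (abs_op A)"
    unfolding nuclear_rep_def
  proof (intro conjI allI)
    show "(\<lambda>e. norm (Q e) * norm (Q e)) summable_on onb"
      using Q(3) by (simp add: hilbert_schmidt_def power2_eq_square)
    fix x y
    \<comment> \<open>Parseval is applied to \<open>Q y\<close> and \<open>Q x\<close>; symmetry
      then moves \<open>Q\<close> onto the basis vectors.\<close>
    have "((\<lambda>e. cinner (Q y) e * cinner e (Q x)) has_sum cinner (Q y) (Q x)) onb"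
      by (rule has_sum_Parseval[OF is_onb_onb])
    then have "((\<lambda>e. cinner y (Q e) * cinner (Q e) x) has_sum cinner y (Q (Q x))) onb"
      by (simp only: positive_op_symmetric[OF Q(1)])
    then show "((\<lambda>e. cinner (Q e) x * cinner y (Q e)) has_sum cinner y (abs_op A x)) onb"
      by (simp add: mult.commute flip: Q(2))
  qed fact
  from nuclear_rep_compose_left[OF U(1) this] show ?thesis unfolding U(3) by (intro exI)
qed

text \<open>The operator norm of \<open>Q\<close> is at most its Hilbert-Schmidt norm, and
  \<open>abs_op A\<close>, the square of \<open>Q\<close>, has the same pointwise norms as
  \<open>A\<close>. Trace-norm limits thereby become limits of matrix elements.\<close>

lemma norm_le_trace_norm:
  assumes "A \<in> trace_class"
  shows "norm A \<le> trace_norm A"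
proof (rule norm_blinfun_bound)
  have A: "A \<in> bounded_ops" using assms by (simp add: trace_class_def)
  obtain Q where Q: "positive_op Q" "Q o\<^sub>L Q = abs_op A" "Q \<in> hilbert_schmidt"
    "trace_norm A = (\<Sum>\<^sub>\<infinity>e\<in>onb. (norm (Q e))\<^sup>2)"
    by (rule trace_class_sqrt[OF assms])
  show "0 \<le> trace_norm A" unfolding Q(4) by (rule infsum_nonneg) simp
  have "norm Q * norm Q \<le> trace_norm A"
    using mult_mono[OF hilbert_schmidt_norm_le[OF Q(3)] hilbert_schmidt_norm_le[OF Q(3)]]
      \<open>0 \<le> trace_norm A\<close> by (simp flip: Q(4))
  then have "norm (abs_op A) \<le> trace_norm A"
    unfolding Q(2)[symmetric] using norm_blinfun_compose[of Q Q] by simp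
  then show "norm (A x) \<le> trace_norm A * norm x" for x
    using norm_blinfun[of "abs_op A" x] mult_right_mono[of "norm (abs_op A)" "trace_norm A" "norm x"]
    by (simp add: abs_op(2)[OF A])
qed

text \<open>Testing against all bounded operators is a condition that is linear in \<open>A\<close>.\<close>

lemma trace_class_iff:
  fixes A :: "'a::complex_hilbert \<Rightarrow>\<^sub>L 'a"
  shows "A \<in> trace_class \<longleftrightarrow>
    A \<in> bounded_ops \<and> (\<forall>U\<in>bounded_ops. (\<lambda>e. cinner e (U (A e))) summable_on onb)"
proof (intro iffI conjI ballI)
  assume "A \<in> trace_class"
  then show "A \<in> bounded_ops" by (simp add: trace_class_def)
  fix U :: "'a \<Rightarrow>\<^sub>L 'a" assume U: "U \<in> bounded_ops"
  obtain a b where "nuclear_rep (onb :: 'a set) a b A"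
    using trace_class_nuclear_rep \<open>A \<in> trace_class\<close> by blast
  from nuclear_rep_tr(1)[OF nuclear_rep_compose_left[OF U this]]
  show "(\<lambda>e. cinner e (U (A e))) summable_on onb" by simp
next
  assume "A \<in> bounded_ops \<and> (\<forall>U\<in>bounded_ops. (\<lambda>e. cinner e (U (A e))) summable_on onb)"
  then have A: "A \<in> bounded_ops"
    and U_A: "\<And>U. U \<in> bounded_ops \<Longrightarrow> (\<lambda>e. cinner e ((U o\<^sub>L A) e)) summable_on onb" by simp_all
  have "abs_op A \<in> bounded_ops" using abs_op(1)[OF A] by (simp add: positive_op_def)
  then obtain U where U: "U \<in> bounded_ops" "U o\<^sub>L A = abs_op A"
    using dominated_factorization[of "abs_op A" A] A abs_op(2)[OF A] by auto
  show "A \<in> trace_class"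
    using A U_A[OF U(1)] by (simp only: U(2) trace_class_def mem_Collect_eq simp_thms)
qed

section \<open>The trace class as a two-sided ideal\<close>

lemma trace_class_0: "0 \<in> trace_class"
  by (simp add: trace_class_iff bounded_ops_0)

lemma trace_class_add: "A \<in> trace_class \<Longrightarrow> B \<in> trace_class \<Longrightarrow> A + B \<in> trace_class"
  by (auto simp: trace_class_iff bounded_ops_add blinfun.bilinear_simps cinner_add_right
      intro: summable_on_add)

lemma trace_class_compose_left: "U \<in> bounded_ops \<Longrightarrow> A \<in> trace_class \<Longrightarrow> U o\<^sub>L A \<in> trace_class"
  by (meson nuclear_rep_compose_left nuclear_rep_trace_class trace_class_nuclear_rep)

lemma trace_class_compose_right: "U \<in> bounded_ops \<Longrightarrow> A \<in> trace_class \<Longrightarrow> A o\<^sub>L U \<in> trace_class"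
  by (meson nuclear_rep_compose_right nuclear_rep_trace_class trace_class_nuclear_rep)

lemma trace_class_diff: "A \<in> trace_class \<Longrightarrow> B \<in> trace_class \<Longrightarrow> A - B \<in> trace_class"
  using trace_class_add[OF _ trace_class_compose_left[OF bounded_ops_scaleR[OF bounded_ops_id]], of A B "- 1"]
    blinfun_eqI[of "((- 1) *\<^sub>R id_blinfun) o\<^sub>L B" "- B"]
  by (simp add: blinfun.bilinear_simps)

lemma trace_class_sum: "(\<And>i. i \<in> I \<Longrightarrow> A i \<in> trace_class) \<Longrightarrow> (\<Sum>i\<in>I. A i) \<in> trace_class"
  by (induction I rule: infinite_finite_induct) (auto simp: trace_class_0 trace_class_add)

section \<open>Rank one operators\<close>

definition rank_one :: "'a::complex_hilbert \<Rightarrow> 'a \<Rightarrow> 'a \<Rightarrow>\<^sub>L 'a" where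
  "rank_one a b = Blinfun (\<lambda>x. cinner b x *\<^sub>C a)"

lemma rank_one_apply [simp]: "rank_one a b x = cinner b x *\<^sub>C a"
proof -
  have "bounded_linear (\<lambda>x. cinner b x *\<^sub>C a)"
  proof (rule bounded_linear_intro[where K = "norm b * norm a"])
    show "norm (cinner b x *\<^sub>C a) \<le> norm x * (norm b * norm a)" for x
      using mult_right_mono[OF cinner_Cauchy_Schwarz[of b x], of "norm a"] by (simp add: mult_ac)
  qed (simp_all add: cinner_add_right scaleC_add_left scaleR_scaleC)
  then show ?thesis by (simp add: rank_one_def bounded_linear_Blinfun_apply)
qed

lemma rank_one_bounded_ops: "rank_one a b \<in> bounded_ops"
  by (simp add: bounded_ops_def)

lemma rank_one_trace_class: "rank_one a b \<in> trace_class"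
  by (rule nuclear_rep_trace_class[where I = "{()}" and a = "\<lambda>_. a" and b = "\<lambda>_. b"])
    (simp add: nuclear_rep_def rank_one_bounded_ops has_sum_finite_iff)

lemma norm_rank_one_sq: "(norm (rank_one a b e))\<^sup>2 = (norm a)\<^sup>2 * (cmod (cinner e b))\<^sup>2"
  by (simp add: power_mult_distrib norm_cinner_commute[of b] mult.commute)

lemma rank_one_hilbert_schmidt: "rank_one a b \<in> hilbert_schmidt"
  unfolding hilbert_schmidt_def mem_Collect_eq norm_rank_one_sq
  by (intro conjI rank_one_bounded_ops summable_on_cmult_right Bessel_infsum orthonormal_onb)

lemma op_of_hs_rank_one [simp]: "op_of_hs (hs_of_op (rank_one a b)) = rank_one a b"
  by (rule hs_of_op_inverse[OF rank_one_hilbert_schmidt])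

lemma norm_hs_rank_one: "norm (hs_of_op (rank_one a b)) = norm a * norm b"
proof -
  have "(norm (hs_of_op (rank_one a b)))\<^sup>2 = (norm a * norm b)\<^sup>2"
    unfolding norm_hs op_of_hs_rank_one norm_rank_one_sq
    by (simp add: infsum_cmult_right' Parseval[OF is_onb_onb] power_mult_distrib)
  then show ?thesis by (simp add: power2_eq_iff_nonneg)
qed

text \<open>With \<open>op_of_hs X\<close> moved to the other side, the trace is a Parseval series.
  This is the passage between inner products of \<open>'a hs\<close> and matrix elements on
  \<open>'a\<close>.\<close>

lemma cinner_hs_rank_one: "cinner (hs_of_op (rank_one a b)) X = cinner a (op_of_hs X b)"
proof -
  have X: "op_of_hs X \<in> bounded_ops"
    using op_of_hs[of X] by (simp add: hilbert_schmidt_def del: op_of_hs)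
  have "cinner (hs_of_op (rank_one a b)) X = (\<Sum>\<^sub>\<infinity>e\<in>onb. cinner (rank_one a b e) (op_of_hs X e))"
    by (simp only: cinner_hs_def op_of_hs_rank_one tr_adj_compose[OF rank_one_bounded_ops])
  also have "\<dots> = (\<Sum>\<^sub>\<infinity>e\<in>onb. cinner (adj (op_of_hs X) a) e * cinner e b)"
    by (intro infsum_cong) (simp add: cinner_adj[OF X] mult.commute flip: cinner_commute)
  also have "\<dots> = cinner (adj (op_of_hs X) a) b"
    by (rule infsumI[OF has_sum_Parseval[OF is_onb_onb]])
  finally show ?thesis by (simp add: cinner_adj[OF X])
qed

section \<open>Kraus operators\<close>

lemma has_sum_sum:
  fixes f :: "'i \<Rightarrow> 'j \<Rightarrow> 'c::topological_comm_monoid_add"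
  assumes "\<And>i. i \<in> I \<Longrightarrow> (f i has_sum s i) A"
  shows "((\<lambda>x. \<Sum>i\<in>I. f i x) has_sum (\<Sum>i\<in>I. s i)) A"
  using assms by (induction I rule: infinite_finite_induct) (auto intro: has_sum_add)

text \<open>A finite partial sum is the quadratic form of
  \<open>\<Sum>j\<in>F. adj (V j) o\<^sub>L V j\<close> at \<open>x\<close>, and the norms of these
  operators are uniformly bounded.\<close>

lemma kraus_sum_sq:
  assumes "kraus_operators \<Phi> J V"
  shows "\<exists>K\<ge>0. \<forall>x. (\<lambda>j. (norm (V j x))\<^sup>2) summable_on J \<and>
    (\<Sum>\<^sub>\<infinity>j\<in>J. (norm (V j x))\<^sup>2) \<le> K * (norm x)\<^sup>2"
proof -
  obtain K where K: "\<And>F. finite F \<Longrightarrow> F \<subseteq> J \<Longrightarrow> norm (\<Sum>j\<in>F. adj (V j) o\<^sub>L V j) \<le> K"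
    using assms unfolding kraus_operators_def by blast
  have V: "V j \<in> bounded_ops" if "j \<in> J" for j
    using assms that by (simp add: kraus_operators_def)
  have partial: "(\<Sum>j\<in>F. (norm (V j x))\<^sup>2) \<le> K * (norm x)\<^sup>2" if F: "finite F" "F \<subseteq> J" for F x
  proof -
    let ?S = "\<Sum>j\<in>F. adj (V j) o\<^sub>L V j"
    have "?S x = (\<Sum>j\<in>F. adj (V j) (V j x))"
      by (simp add: blinfun.sum_left)
    then have "cinner x (?S x) = (\<Sum>j\<in>F. cinner (V j x) (V j x))"
      using F V by (simp add: cinner_sum_right) (intro sum.cong cinner_adj_right, auto)
    also have "\<dots> = of_real (\<Sum>j\<in>F. (norm (V j x))\<^sup>2)"
      by (simp add: cinner_self)
    finally have "(\<Sum>j\<in>F. (norm (V j x))\<^sup>2) = inner x (?S x)"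
      by (simp add: inner_eq_Re_cinner)
    also have "\<dots> \<le> norm x * norm (?S x)" by (rule norm_cauchy_schwarz)
    also have "\<dots> \<le> norm x * (K * norm x)"
      by (intro mult_left_mono order_trans[OF norm_blinfun] mult_right_mono K F) auto
    finally show ?thesis by (simp add: power2_eq_square mult_ac)
  qed
  have summ: "(\<lambda>j. (norm (V j x))\<^sup>2) summable_on J" for x
    by (rule nonneg_bounded_partial_sums_imp_summable_on[where C = "K * (norm x)\<^sup>2"])
      (auto intro!: eventually_finite_subsets_at_top_weakI partial)
  show ?thesis
  proof (intro exI[of _ K] conjI allI summ infsum_le_finite_sums[OF summ partial])
    show "0 \<le> K" using K[of "{}"] by simp
  qed
qed

lemma kraus_has_sum:
  assumes \<Phi>: "\<Phi> \<in> CP" and kraus: "kraus_operators \<Phi> J V" and A: "A \<in> trace_class"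
  shows "((\<lambda>j. cinner x (V j (A (adj (V j) y)))) has_sum cinner x (\<Phi> A y)) J"
  unfolding has_sum_def
proof (rule LIM_zero_cancel, rule Lim_null_comparison)
  let ?D = "\<lambda>F. \<Phi> A - (\<Sum>j\<in>F. V j o\<^sub>L A o\<^sub>L adj (V j))"
  have V: "V j \<in> bounded_ops" if "j \<in> J" for j
    using kraus that by (simp add: kraus_operators_def)
  have "cmod ((\<Sum>j\<in>F. cinner x (V j (A (adj (V j) y)))) - cinner x (\<Phi> A y))
      \<le> norm x * norm y * trace_norm (?D F)" if F: "finite F" "F \<subseteq> J" for F
  proof -
    \<comment> \<open>Membership is established first because \<open>norm_le_trace_norm\<close>
      applies to trace class operators.\<close>
    have "?D F \<in> trace_class"
      using \<Phi> A F V
      by (intro trace_class_diff trace_class_sum trace_class_compose_left trace_class_compose_right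
          bounded_ops_adj) (auto simp: CP_def)
    then have "norm (?D F y) \<le> trace_norm (?D F) * norm y"
      by (intro order_trans[OF norm_blinfun] mult_right_mono norm_le_trace_norm) auto
    then have "norm x * norm (?D F y) \<le> norm x * (trace_norm (?D F) * norm y)"
      by (rule mult_left_mono) simp
    moreover have "(\<Sum>j\<in>F. cinner x (V j (A (adj (V j) y)))) - cinner x (\<Phi> A y)
        = - cinner x (?D F y)"
      by (simp add: blinfun.diff_left blinfun.sum_left cinner_diff_right cinner_sum_right)
    ultimately show ?thesis
      using cinner_Cauchy_Schwarz[of x "?D F y"] by (simp add: mult_ac)
  qed
  then show "\<forall>\<^sub>F F in finite_subsets_at_top J.
      cmod ((\<Sum>j\<in>F. cinner x (V j (A (adj (V j) y)))) - cinner x (\<Phi> A y))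
      \<le> norm x * norm y * trace_norm (?D F)"
    by (rule eventually_finite_subsets_at_top_weakI)
  have "((\<lambda>F. trace_norm (?D F)) \<longlongrightarrow> 0) (finite_subsets_at_top J)"
    using kraus A by (simp add: kraus_operators_def)
  then show "((\<lambda>F. norm x * norm y * trace_norm (?D F)) \<longlongrightarrow> 0) (finite_subsets_at_top J)"
    by (rule tendsto_mult_right_zero)
qed

lemma kraus_rank_one_has_sum:
  assumes "\<Phi> \<in> CP" "kraus_operators \<Phi> J V"
  shows "((\<lambda>j. cinner x (V j a) * cinner (V j b) y) has_sum cinner x (\<Phi> (rank_one a b) y)) J"
proof (subst has_sum_cong)
  show "cinner x (V j a) * cinner (V j b) y = cinner x (V j (rank_one a b (adj (V j) y)))"
    if "j \<in> J" for j
    using assms(2) that by (simp add: kraus_operators_def bounded_ops_apply cinner_adj_right)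
qed (rule kraus_has_sum[OF assms rank_one_trace_class])

text \<open>Cauchy-Schwarz over \<open>j\<close> bounds
  \<open>(norm (\<Phi> (rank_one a b) f))\<^sup>2\<close> by \<open>K * (norm a)\<^sup>2\<close>
  times the sum of \<open>(cmod (cinner f (V j b)))\<^sup>2\<close>. Summing over basis vectors
  \<open>f\<close>, Bessel for each \<open>j\<close> leaves the sum of
  \<open>(norm (V j b))\<^sup>2\<close>, at most \<open>K * (norm b)\<^sup>2\<close>.\<close>

lemma kraus_rank_one_hs:
  assumes \<Phi>: "\<Phi> \<in> CP" and kraus: "kraus_operators \<Phi> J V"
    and "0 \<le> K" and summ: "\<And>x. (\<lambda>j. (norm (V j x))\<^sup>2) summable_on J"
    and K: "\<And>x. (\<Sum>\<^sub>\<infinity>j\<in>J. (norm (V j x))\<^sup>2) \<le> K * (norm x)\<^sup>2"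
  shows "\<Phi> (rank_one a b) \<in> hilbert_schmidt"
    and "norm (hs_of_op (\<Phi> (rank_one a b))) \<le> K * norm a * norm b"
proof -
  let ?M = "\<Phi> (rank_one a b)"
  define r where "r = (\<lambda>f j. (cmod (cinner f (V j b)))\<^sup>2)"
  have r: "r f summable_on J" for f
  proof (rule summable_on_comparison_test)
    show "(\<lambda>j. (norm f)\<^sup>2 * (norm (V j b))\<^sup>2) summable_on J"
      by (rule summable_on_cmult_right[OF summ])
    show "r f j \<le> (norm f)\<^sup>2 * (norm (V j b))\<^sup>2" for j
      unfolding r_def power_mult_distrib[symmetric]
      by (intro power_mono cinner_Cauchy_Schwarz) simp
  qed (simp add: r_def)
  have M: "(norm (?M f))\<^sup>2 \<le> K * (norm a)\<^sup>2 * (\<Sum>\<^sub>\<infinity>j\<in>J. r f j)" for f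
  proof -
    define m where "m = ?M f"
    have terms: "cmod (cinner m (V j a) * cinner (V j b) f)
        \<le> norm m * (norm (V j a) * cmod (cinner f (V j b)))" for j
      using mult_right_mono[OF cinner_Cauchy_Schwarz[of m "V j a"], of "cmod (cinner f (V j b))"]
      by (simp add: norm_mult norm_cinner_commute[of "V j b"] mult_ac)
    \<comment> \<open>Pairing \<open>m\<close> with itself brings in the weak Kraus series; the
      common factor \<open>norm m\<close> is cancelled below.\<close>
    have "norm m * norm m = cmod (cinner m (?M f))"
      by (simp add: m_def cinner_self norm_mult power2_eq_square)
    also have "\<dots> \<le> (\<Sum>\<^sub>\<infinity>j\<in>J. norm m * (norm (V j a) * cmod (cinner f (V j b))))"
    proof -
      have CS: "(\<lambda>j. norm (V j a) * cmod (cinner f (V j b))) summable_on J"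
        using r[of f] by (intro infsum_mult_le summ) (simp_all add: r_def)
      show ?thesis
        by (rule norm_infsum_le[OF kraus_rank_one_has_sum[OF \<Phi> kraus]
              has_sum_infsum[OF summable_on_cmult_right[OF CS]] terms])
    qed
    also have "\<dots> = norm m * (\<Sum>\<^sub>\<infinity>j\<in>J. norm (V j a) * cmod (cinner f (V j b)))"
      by (rule infsum_cmult_right')
    finally have "norm m \<le> (\<Sum>\<^sub>\<infinity>j\<in>J. norm (V j a) * cmod (cinner f (V j b)))"
      by (cases "m = 0") (auto intro: infsum_nonneg)
    also have "\<dots> \<le> sqrt (\<Sum>\<^sub>\<infinity>j\<in>J. (norm (V j a))\<^sup>2) * sqrt (\<Sum>\<^sub>\<infinity>j\<in>J. r f j)"
      unfolding r_def using r[of f] by (intro infsum_mult_le summ) (simp_all add: r_def)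
    also have "\<dots> \<le> sqrt (K * (norm a)\<^sup>2) * sqrt (\<Sum>\<^sub>\<infinity>j\<in>J. r f j)"
      by (intro mult_right_mono real_sqrt_le_mono K) (simp add: r_def infsum_nonneg)
    finally have "(norm m)\<^sup>2 \<le> (sqrt (K * (norm a)\<^sup>2) * sqrt (\<Sum>\<^sub>\<infinity>j\<in>J. r f j))\<^sup>2"
      by (rule power_mono) simp
    also have "\<dots> = K * (norm a)\<^sup>2 * (\<Sum>\<^sub>\<infinity>j\<in>J. r f j)"
      using \<open>0 \<le> K\<close> by (simp add: power_mult_distrib r_def infsum_nonneg)
    finally show ?thesis by (simp add: m_def)
  qed
  have partial: "(\<Sum>f\<in>G. (norm (?M f))\<^sup>2) \<le> (K * norm a * norm b)\<^sup>2"
    if G: "finite G" "G \<subseteq> onb" for G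
  proof -
    have "((\<lambda>j. \<Sum>f\<in>G. r f j) has_sum (\<Sum>f\<in>G. \<Sum>\<^sub>\<infinity>j\<in>J. r f j)) J"
      by (intro has_sum_sum has_sum_infsum r)
    then have "(\<Sum>f\<in>G. \<Sum>\<^sub>\<infinity>j\<in>J. r f j) \<le> (\<Sum>\<^sub>\<infinity>j\<in>J. (norm (V j b))\<^sup>2)"
      by (rule has_sum_mono[OF _ has_sum_infsum[OF summ]])
        (simp add: r_def Bessel[OF orthonormal_onb G])
    also have "\<dots> \<le> K * (norm b)\<^sup>2" by (rule K)
    finally have "(\<Sum>f\<in>G. \<Sum>\<^sub>\<infinity>j\<in>J. r f j) \<le> K * (norm b)\<^sup>2" .
    then have "K * (norm a)\<^sup>2 * (\<Sum>f\<in>G. \<Sum>\<^sub>\<infinity>j\<in>J. r f j) \<le> K * (norm a)\<^sup>2 * (K * (norm b)\<^sup>2)"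
      by (rule mult_left_mono) (simp add: \<open>0 \<le> K\<close>)
    moreover have "(\<Sum>f\<in>G. (norm (?M f))\<^sup>2) \<le> (\<Sum>f\<in>G. K * (norm a)\<^sup>2 * (\<Sum>\<^sub>\<infinity>j\<in>J. r f j))"
      by (rule sum_mono[OF M])
    ultimately show ?thesis
      by (simp add: sum_distrib_left[symmetric] power2_eq_square mult_ac)
  qed
  have M_summ: "(\<lambda>f. (norm (?M f))\<^sup>2) summable_on onb"
    by (rule nonneg_bounded_partial_sums_imp_summable_on[where C = "(K * norm a * norm b)\<^sup>2"])
      (auto intro!: eventually_finite_subsets_at_top_weakI partial)
  have "?M \<in> trace_class" using \<Phi> by (simp add: CP_def rank_one_trace_class)
  then have "?M \<in> bounded_ops" by (simp add: trace_class_def)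
  then show M_hs: "?M \<in> hilbert_schmidt" using M_summ by (simp add: hilbert_schmidt_def)
  have "(norm (hs_of_op ?M))\<^sup>2 \<le> (K * norm a * norm b)\<^sup>2"
    unfolding norm_hs hs_of_op_inverse[OF M_hs] by (rule infsum_le_finite_sums[OF M_summ partial])
  then show "norm (hs_of_op ?M) \<le> K * norm a * norm b"
    by (rule power2_le_imp_le) (simp add: \<open>0 \<le> K\<close>)
qed

text \<open>Cauchy-Schwarz over \<open>j\<close> gives a row bound
  \<open>K * (norm u * norm v)\<close>, so the family is absolutely summable over \<open>I\<close>
  and \<open>J\<close> together. The weight \<open>c\<close> covers two uses: matrix elements of
  \<open>X\<close> when identifying the operator, and 1 when computing its trace.\<close>

lemma kraus_swap:
  fixes V :: "'j \<Rightarrow> 'a::complex_hilbert \<Rightarrow>\<^sub>L 'a" and x y p q :: "'k \<Rightarrow> 'a"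
  assumes summ: "\<And>x. (\<lambda>j. (norm (V j x))\<^sup>2) summable_on J"
    and K: "\<And>x. (\<Sum>\<^sub>\<infinity>j\<in>J. (norm (V j x))\<^sup>2) \<le> K * (norm x)\<^sup>2" and "0 \<le> K"
    and xy: "(\<lambda>k. cmod (c k) * (norm (x k) * norm (p k) * (norm (q k) * norm (y k)))) summable_on I"
  defines "t \<equiv> \<lambda>k j. c k * (cinner (x k) (V j (p k)) * cinner (V j (q k)) (y k))"
  shows "(\<lambda>j. \<Sum>\<^sub>\<infinity>k\<in>I. t k j) summable_on J"
    and "(\<Sum>\<^sub>\<infinity>k\<in>I. \<Sum>\<^sub>\<infinity>j\<in>J. t k j) = (\<Sum>\<^sub>\<infinity>j\<in>J. \<Sum>\<^sub>\<infinity>k\<in>I. t k j)"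
proof -
  have VV: "(\<lambda>j. norm (V j u) * norm (V j v)) summable_on J"
    "(\<Sum>\<^sub>\<infinity>j\<in>J. norm (V j u) * norm (V j v)) \<le> K * (norm u * norm v)" for u v
  proof -
    show "(\<lambda>j. norm (V j u) * norm (V j v)) summable_on J"
      by (intro infsum_mult_le summ) simp_all
    have "(\<Sum>\<^sub>\<infinity>j\<in>J. norm (V j u) * norm (V j v))
        \<le> sqrt (\<Sum>\<^sub>\<infinity>j\<in>J. (norm (V j u))\<^sup>2) * sqrt (\<Sum>\<^sub>\<infinity>j\<in>J. (norm (V j v))\<^sup>2)"
      by (intro infsum_mult_le summ) simp_all
    also have "\<dots> \<le> sqrt (K * (norm u)\<^sup>2) * sqrt (K * (norm v)\<^sup>2)"
      by (intro mult_mono real_sqrt_le_mono K) (auto simp: infsum_nonneg \<open>0 \<le> K\<close>)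
    also have "\<dots> = sqrt ((K * (norm u * norm v))\<^sup>2)"
      by (simp add: power2_eq_square mult_ac flip: real_sqrt_mult)
    finally show "(\<Sum>\<^sub>\<infinity>j\<in>J. norm (V j u) * norm (V j v)) \<le> K * (norm u * norm v)"
      using \<open>0 \<le> K\<close> by simp
  qed
  define d where "d k = cmod (c k) * (norm (x k) * norm (y k))" for k
  have t_le: "cmod (t k j) \<le> d k * (norm (V j (p k)) * norm (V j (q k)))" for k j
  proof -
    have "cmod (cinner (x k) (V j (p k)) * cinner (V j (q k)) (y k))
        \<le> (norm (x k) * norm (V j (p k))) * (norm (V j (q k)) * norm (y k))"
      unfolding norm_mult by (intro mult_mono cinner_Cauchy_Schwarz) auto
    from mult_left_mono[OF this, of "cmod (c k)"] show ?thesis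
      by (simp add: t_def d_def norm_mult mult_ac)
  qed
  have t_abs: "(\<lambda>j. cmod (t k j)) summable_on J" for k
    by (rule Infinite_Sum.abs_summable_on_comparison_test'[OF summable_on_cmult_right[OF VV(1)] t_le])
  have "(\<lambda>(k, j). t k j) summable_on I \<times> J"
  proof (rule summable_on_Times_complex[OF t_abs])
    show "(\<lambda>k. K * (cmod (c k) * (norm (x k) * norm (p k) * (norm (q k) * norm (y k))))) summable_on I"
      by (rule summable_on_cmult_right[OF xy])
    fix k
    have "(\<Sum>\<^sub>\<infinity>j\<in>J. cmod (t k j)) \<le> (\<Sum>\<^sub>\<infinity>j\<in>J. d k * (norm (V j (p k)) * norm (V j (q k))))"
      by (intro infsum_mono t_abs t_le summable_on_cmult_right VV)
    also have "\<dots> = d k * (\<Sum>\<^sub>\<infinity>j\<in>J. norm (V j (p k)) * norm (V j (q k)))"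
      by (rule infsum_cmult_right')
    also have "\<dots> \<le> d k * (K * (norm (p k) * norm (q k)))"
      by (intro mult_left_mono VV) (simp add: d_def)
    finally show "(\<Sum>\<^sub>\<infinity>j\<in>J. cmod (t k j))
        \<le> K * (cmod (c k) * (norm (x k) * norm (p k) * (norm (q k) * norm (y k))))"
      by (simp add: d_def mult_ac)
  qed
  then show "(\<Sum>\<^sub>\<infinity>k\<in>I. \<Sum>\<^sub>\<infinity>j\<in>J. t k j) = (\<Sum>\<^sub>\<infinity>j\<in>J. \<Sum>\<^sub>\<infinity>k\<in>I. t k j)"
    and "(\<lambda>j. \<Sum>\<^sub>\<infinity>k\<in>I. t k j) summable_on J"
    by (rule infsum_swap_banach, subst (asm) summable_on_swap)
      (auto dest: summable_on_Sigma_banach)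
qed

theorem lemma4p4:
  fixes B :: "'a::complex_hilbert \<Rightarrow>\<^sub>L 'a"
    and \<Phi> :: "('a \<Rightarrow>\<^sub>L 'a) \<Rightarrow> 'a \<Rightarrow>\<^sub>L 'a"
    and J :: "'j set"
    and V :: "'j \<Rightarrow> 'a \<Rightarrow>\<^sub>L 'a"
  assumes "B \<in> trace_class"
    and "\<Phi> \<in> CP"
    and "kraus_operators \<Phi> J V"
  shows "(\<lambda>j. tr (adj B o\<^sub>L V j)) \<in> ell2 J \<and>
    (\<exists>T :: 'a hs \<Rightarrow>\<^sub>L 'a hs.
      (\<forall>X. op_of_hs (blinfun_apply T X) = \<Phi> (adj B o\<^sub>L op_of_hs X o\<^sub>L B)) \<and>
      T \<in> trace_class \<and>
      tr T = complex_of_real ((ell2_norm J (\<lambda>j. tr (adj B o\<^sub>L V j)))\<^sup>2))"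
proof -
  have B: "B \<in> bounded_ops" using assms(1) by (simp add: trace_class_def)
  have V: "V j \<in> bounded_ops" if "j \<in> J" for j
    using assms(3) that by (simp add: kraus_operators_def)
  obtain a b where ab: "nuclear_rep (onb :: 'a set) a b B"
    using trace_class_nuclear_rep[OF assms(1)] by blast
  have ab_summ: "(\<lambda>e. norm (a e) * norm (b e)) summable_on onb"
    using ab by (simp add: nuclear_rep_def)
  obtain K where "0 \<le> K" and K_summ: "\<And>x. (\<lambda>j. (norm (V j x))\<^sup>2) summable_on J"
    and K: "\<And>x. (\<Sum>\<^sub>\<infinity>j\<in>J. (norm (V j x))\<^sup>2) \<le> K * (norm x)\<^sup>2"
    using kraus_sum_sq[OF assms(3)] by blast

  \<comment> \<open>The operator \<open>T\<close> as a nuclear series on the Hilbert-Schmidt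
    space\<close>
  let ?I = "onb \<times> onb :: ('a \<times> 'a) set"
  have ab2: "(\<lambda>(e, f). (norm (a e) * norm (b e)) * (norm (a f) * norm (b f))) summable_on ?I"
    by (rule summable_on_Times_real[OF ab_summ ab_summ])
  define G where "G = (\<lambda>(e, f). hs_of_op (rank_one (a e) (a f)))"
  define M where "M = (\<lambda>(e, f). hs_of_op (\<Phi> (rank_one (b e) (b f))))"
  have "(\<lambda>i. norm (M i) * norm (G i)) summable_on ?I"
  proof (rule summable_on_comparison_test)
    show "(\<lambda>i. K * (case i of (e, f) \<Rightarrow> (norm (a e) * norm (b e)) * (norm (a f) * norm (b f))))
        summable_on ?I"
      by (rule summable_on_cmult_right[OF ab2])
    show "norm (M i) * norm (G i)
        \<le> K * (case i of (e, f) \<Rightarrow> (norm (a e) * norm (b e)) * (norm (a f) * norm (b f)))" for i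
    proof (cases i)
      case (Pair e f)
      have "norm (M i) * norm (G i) \<le> (K * norm (b e) * norm (b f)) * norm (G i)"
        unfolding M_def Pair prod.case
        by (intro mult_right_mono kraus_rank_one_hs[OF assms(2,3) \<open>0 \<le> K\<close> K_summ K]) simp
      then show ?thesis by (simp add: G_def Pair norm_hs_rank_one mult_ac)
    qed
  qed simp
  from nuclear_rep_exists[OF this] obtain T where T: "nuclear_rep ?I M G T" by blast

  \<comment> \<open>Identification of \<open>T\<close> with the sandwiched map\<close>
  have M_weak: "cinner x (op_of_hs (M (e, f)) y)
      = (\<Sum>\<^sub>\<infinity>j\<in>J. cinner x (V j (b e)) * cinner (V j (b f)) y)" for x y e f
    using infsumI[OF kraus_rank_one_has_sum[OF assms(2,3)]]
    by (simp add: M_def hs_of_op_inverse kraus_rank_one_hs(1)[OF assms(2,3) \<open>0 \<le> K\<close> K_summ K])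
  have T_eq: "op_of_hs (T X) = \<Phi> (adj B o\<^sub>L op_of_hs X o\<^sub>L B)" for X
  proof (intro blinfun_eqI cinner_eqI')
    fix x y
    let ?A = "adj B o\<^sub>L op_of_hs X o\<^sub>L B"
    let ?t = "\<lambda>(e, f) j. cinner (a e) (op_of_hs X (a f)) *
      (cinner x (V j (b e)) * cinner (V j (b f)) y)"
    have X: "op_of_hs X \<in> bounded_ops"
      using op_of_hs[of X] by (simp add: hilbert_schmidt_def del: op_of_hs)
    have A: "?A \<in> trace_class"
      by (intro trace_class_compose_left assms(1) bounded_ops_compose bounded_ops_adj B X)
    \<comment> \<open>Writing the matrix element as an inner product with a rank one operator makes
      the nuclear expansion of \<open>T\<close> applicable.\<close>
    have "cinner x (op_of_hs (T X) y) = cinner (hs_of_op (rank_one x y)) (T X)"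
      by (simp add: cinner_hs_rank_one)
    also have "\<dots> = (\<Sum>\<^sub>\<infinity>i\<in>?I. cinner (G i) X * cinner (hs_of_op (rank_one x y)) (M i))"
      using T by (auto simp: nuclear_rep_def intro!: infsumI[symmetric])
    also have "\<dots> = (\<Sum>\<^sub>\<infinity>i\<in>?I. \<Sum>\<^sub>\<infinity>j\<in>J. ?t i j)"
      by (intro infsum_cong) (auto simp: G_def cinner_hs_rank_one M_weak infsum_cmult_right')
    also have "\<dots> = (\<Sum>\<^sub>\<infinity>j\<in>J. \<Sum>\<^sub>\<infinity>i\<in>?I. ?t i j)"
    proof -
      have "(\<lambda>i. cmod (cinner (a (fst i)) (op_of_hs X (a (snd i)))) *
          (norm x * norm (b (fst i)) * (norm (b (snd i)) * norm y))) summable_on ?I"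
      proof (rule summable_on_comparison_test)
        show "(\<lambda>i. (norm x * norm y * norm (op_of_hs X)) *
            (case i of (e, f) \<Rightarrow> (norm (a e) * norm (b e)) * (norm (a f) * norm (b f)))) summable_on ?I"
          by (rule summable_on_cmult_right[OF ab2])
        fix i :: "'a \<times> 'a"
        obtain e f where i: "i = (e, f)" by fastforce
        have "cmod (cinner (a e) (op_of_hs X (a f))) \<le> norm (a e) * (norm (op_of_hs X) * norm (a f))"
          by (intro order_trans[OF cinner_Cauchy_Schwarz] mult_left_mono norm_blinfun) simp
        from mult_right_mono[OF this, of "norm x * norm (b e) * (norm (b f) * norm y)"]
        show "cmod (cinner (a (fst i)) (op_of_hs X (a (snd i)))) *
            (norm x * norm (b (fst i)) * (norm (b (snd i)) * norm y))
          \<le> (norm x * norm y * norm (op_of_hs X)) *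
            (case i of (e, f) \<Rightarrow> (norm (a e) * norm (b e)) * (norm (a f) * norm (b f)))"
          by (simp add: i mult_ac)
      qed simp
      from kraus_swap(2)[OF K_summ K \<open>0 \<le> K\<close> this] show ?thesis
        by (simp add: case_prod_unfold)
    qed
    also have "\<dots> = (\<Sum>\<^sub>\<infinity>j\<in>J. cinner x (V j (?A (adj (V j) y))))"
    proof (rule infsum_cong)
      fix j assume j: "j \<in> J"
      \<comment> \<open>With \<open>V j\<close> moved to the outer vectors, each Kraus term is a
        matrix element of \<open>?A\<close> between \<open>u\<close> and \<open>v\<close>. The
        factor \<open>adj B\<close> is expanded with \<open>a\<close> and \<open>b\<close>
        exchanged, then \<open>B\<close> with them in place, and \<open>s\<close> merges the
        iterated sums.\<close>
      define u v where "u = adj (V j) x" and "v = adj (V j) y"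
      let ?s = "\<lambda>e f. cinner (a e) (op_of_hs X (a f)) * (cinner u (b e) * cinner (b f) v)"
      have s: "(\<lambda>(e, f). ?s e f) summable_on ?I"
      proof (rule abs_summable_summable, rule Infinite_Sum.abs_summable_on_comparison_test')
        show "(\<lambda>i. (norm u * norm v * norm (op_of_hs X)) *
            (case i of (e, f) \<Rightarrow> (norm (a e) * norm (b e)) * (norm (a f) * norm (b f)))) summable_on ?I"
          by (rule summable_on_cmult_right[OF ab2])
        fix i :: "'a \<times> 'a"
        obtain e f where i: "i = (e, f)" by fastforce
        have "cmod (cinner (a e) (op_of_hs X (a f))) \<le> norm (a e) * (norm (op_of_hs X) * norm (a f))"
          by (intro order_trans[OF cinner_Cauchy_Schwarz] mult_left_mono norm_blinfun) simp
        then have "cmod (?s e f) \<le> (norm (a e) * (norm (op_of_hs X) * norm (a f))) *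
            ((norm u * norm (b e)) * (norm (b f) * norm v))"
          unfolding norm_mult by (intro mult_mono cinner_Cauchy_Schwarz) auto
        then show "cmod (case i of (e, f) \<Rightarrow> ?s e f) \<le> (norm u * norm v * norm (op_of_hs X)) *
            (case i of (e, f) \<Rightarrow> (norm (a e) * norm (b e)) * (norm (a f) * norm (b f)))"
          by (simp add: i mult_ac)
      qed
      have "cinner x (V j (?A v)) = cinner u (adj B (op_of_hs X (B v)))"
        by (simp add: u_def cinner_adj[OF V[OF j]])
      also have "\<dots> = (\<Sum>\<^sub>\<infinity>e\<in>onb. cinner (a e) (op_of_hs X (B v)) * cinner u (b e))"
        using nuclear_rep_adj[OF ab] by (auto simp: nuclear_rep_def intro!: infsumI[symmetric])
      also have "\<dots> = (\<Sum>\<^sub>\<infinity>e\<in>onb. \<Sum>\<^sub>\<infinity>f\<in>onb. ?s e f)"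
      proof (rule infsum_cong)
        fix e
        have "((\<lambda>f. cinner (b f) v * cinner (adj (op_of_hs X) (a e)) (a f))
            has_sum cinner (adj (op_of_hs X) (a e)) (B v)) onb"
          using ab by (simp add: nuclear_rep_def)
        then have "cinner (a e) (op_of_hs X (B v))
            = (\<Sum>\<^sub>\<infinity>f\<in>onb. cinner (a e) (op_of_hs X (a f)) * cinner (b f) v)"
          by (simp add: cinner_adj[OF X] mult.commute infsumI)
        then show "cinner (a e) (op_of_hs X (B v)) * cinner u (b e) = (\<Sum>\<^sub>\<infinity>f\<in>onb. ?s e f)"
          by (simp add: mult_ac infsum_cmult_right')
      qed
      also have "\<dots> = (\<Sum>\<^sub>\<infinity>(e, f)\<in>?I. ?s e f)" by (rule infsum_Sigma'_banach[OF s])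
      finally show "(\<Sum>\<^sub>\<infinity>i\<in>?I. ?t i j) = cinner x (V j (?A (adj (V j) y)))"
        by (simp add: u_def v_def cinner_adj[OF V[OF j]] cinner_adj_right[OF V[OF j]] case_prod_unfold)
    qed
    also have "\<dots> = cinner x (\<Phi> ?A y)"
      by (rule infsumI[OF kraus_has_sum[OF assms(2,3) A]])
    finally show "cinner x (op_of_hs (T X) y) = cinner x (\<Phi> ?A y)" .
  qed

  \<comment> \<open>Square-summability and the trace\<close>
  let ?v = "\<lambda>j. tr (adj B o\<^sub>L V j)"
  let ?t = "\<lambda>(e, f) j. 1 * (cinner (a e) (V j (b e)) * cinner (V j (b f)) (a f))"
  \<comment> \<open>The sum over pairs factors into the nuclear series of \<open>?v j\<close> and
    the conjugate series.\<close>
  have v_sq: "(\<Sum>\<^sub>\<infinity>i\<in>?I. ?t i j) = of_real ((cmod (?v j))\<^sup>2)" if j: "j \<in> J" for j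
  proof -
    have rep: "nuclear_rep onb b (\<lambda>e. adj (V j) (a e)) (adj B o\<^sub>L V j)"
      by (rule nuclear_rep_compose_right[OF V[OF j] nuclear_rep_adj[OF ab]])
    have v: "?v j = (\<Sum>\<^sub>\<infinity>e\<in>onb. cinner (a e) (V j (b e)))"
      using nuclear_rep_tr(2)[OF rep] by (simp add: cinner_adj[OF V[OF j]])
    then have "cnj (?v j) = (\<Sum>\<^sub>\<infinity>e\<in>onb. cinner (V j (b e)) (a e))"
      by (simp flip: infsum_cnj cinner_commute)
    moreover have summ: "(\<lambda>e. cinner (a e) (V j (b e))) summable_on onb"
    proof (rule abs_summable_summable, rule Infinite_Sum.abs_summable_on_comparison_test')
      show "(\<lambda>e. norm (V j) * (norm (a e) * norm (b e))) summable_on onb"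
        by (rule summable_on_cmult_right[OF ab_summ])
      show "cmod (cinner (a e) (V j (b e))) \<le> norm (V j) * (norm (a e) * norm (b e))" for e
        using order_trans[OF cinner_Cauchy_Schwarz[of "a e"]
            mult_left_mono[OF norm_blinfun[of "V j" "b e"] norm_ge_zero]]
        by (simp add: mult_ac)
    qed
    moreover have "(\<lambda>e. cinner (V j (b e)) (a e)) summable_on onb"
      using summ summable_on_cnj_iff[of "\<lambda>e. cinner (a e) (V j (b e))"]
      by (simp flip: cinner_commute)
    ultimately show ?thesis
      using infsum_Times_mult(2)[of "\<lambda>e. cinner (a e) (V j (b e))" onb
          "\<lambda>f. cinner (V j (b f)) (a f)" onb]
      by (simp only: complex_norm_square v mult_1_left case_prod_unfold)
  qed
  have c: "(\<lambda>i. cmod 1 * (norm (a (fst i)) * norm (b (fst i)) * (norm (b (snd i)) * norm (a (snd i)))))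
      summable_on ?I"
    using ab2 by (simp add: case_prod_unfold mult_ac)
  have swap: "(\<lambda>j. \<Sum>\<^sub>\<infinity>i\<in>?I. ?t i j) summable_on J"
    "(\<Sum>\<^sub>\<infinity>i\<in>?I. \<Sum>\<^sub>\<infinity>j\<in>J. ?t i j) = (\<Sum>\<^sub>\<infinity>j\<in>J. \<Sum>\<^sub>\<infinity>i\<in>?I. ?t i j)"
    using kraus_swap[OF K_summ K \<open>0 \<le> K\<close> c] by (simp_all only: case_prod_unfold)
  \<comment> \<open>By \<open>v_sq\<close> the terms of \<open>swap(1)\<close> are the squared
    moduli, so the real part of that series gives membership in \<open>ell2\<close>.\<close>
  have v_summ: "(\<lambda>j. (cmod (?v j))\<^sup>2) summable_on J"
    using summable_on_Re[OF swap(1)] v_sq by (simp cong: summable_on_cong)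
  have "tr T = (\<Sum>\<^sub>\<infinity>i\<in>?I. cinner (G i) (M i))" by (rule nuclear_rep_tr(2)[OF T])
  also have "\<dots> = (\<Sum>\<^sub>\<infinity>i\<in>?I. \<Sum>\<^sub>\<infinity>j\<in>J. ?t i j)"
    by (intro infsum_cong) (auto simp: G_def cinner_hs_rank_one M_weak)
  also have "\<dots> = (\<Sum>\<^sub>\<infinity>j\<in>J. of_real ((cmod (?v j))\<^sup>2))"
    unfolding swap(2) by (rule infsum_cong[OF v_sq])
  also have "\<dots> = of_real (\<Sum>\<^sub>\<infinity>j\<in>J. (cmod (?v j))\<^sup>2)"
    by (rule infsumI[OF has_sum_of_real[OF has_sum_infsum[OF v_summ]]])
  also have "\<dots> = of_real ((ell2_norm J ?v)\<^sup>2)"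
    by (simp add: ell2_norm_def infsum_nonneg)
  finally have tr: "tr T = of_real ((ell2_norm J ?v)\<^sup>2)" .
  show ?thesis
    using v_summ T_eq nuclear_rep_trace_class[OF T] tr unfolding ell2_def by blast
qed

end
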